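(* For all compositions $\beta,\gamma$, $$\mathcal S_{\gamma/\!/\beta}=\sum_{T\in SSCT(\gamma/\!/\beta)}\mathbf x^{\mathrm{cont}(T)}=\sum_{T\in SCT(\gamma/\!/\beta)}L_{\mathrm{Des}(T)} .$$
   Context: Compositions and diagrams. A composition is a finite (possibly empty) sequence of positive integers; a weak composition is a finite sequence of nonnegative integers (identified up to trailing zeros). $|\alpha|$ is the sum of the parts, $\ell(\alpha)$ the number of parts. The diagram of $\alpha$ is the left-justified array of cells with $\alpha_i$ cells in row $i$, rows numbered from the top; cells are indexed (row, column). Write $\beta\Subset\gamma$ if $\ell(\beta)\le\ell(\gamma)$ and $\beta_{\ell(\beta)-i}\le\gamma_{\ell(\gamma)-i}$ for $0\le i<\ell(\beta)$. In that case the diagram of $\beta$ is placed in the lower left of that of $\gamma$ (last row of $\beta$ in row $\ell(\gamma)$), and $\gamma/\!/\beta$ consists of the cells of $\gamma$ not in $\beta$. Composition tableaux. Cell $(i,k)$ attacks $(j,k+1)$ if $i<j$, $(j,k+1)\in\gamma/\!/\beta$ and $(i,k+1)\notin\beta$ (possibly $(i,k)\in\beta$). An SSCT of shape $\gamma/\!/\beta$ is a filling $T$ of the cells of $\gamma/\!/\beta$ by positive integers such that: (1) row entries weakly decrease left to right; (2) entries in the first column strictly increase top to bottom; (3) if $(i,k)\in\gamma$ attacks $(j,k+1)$ and either $(i,k)\in\beta$ or $T(j,k+1)\le T(i,k)$, then $(i,k+1)\in\gamma/\!/\beta$ and $T(j,k+1)<T(i,k+1)$. It is an SCT (standard) if moreover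 it is a bijection onto $\{1,\dots,n\}$, $n=|\gamma|-|\beta|$. $SSCT(\gamma/\!/\beta)$ and $SCT(\gamma/\!/\beta)$ are the sets of all such tableaux; they are empty if $\beta\not\Subset\gamma$. $\mathrm{cont}(T)$ is the weak composition whose $i$-th part is the number of entries equal to $i$; $\mathbf x^\tau=\prod x_i^{\tau_i}$. Descents. For a standard tableau $T$ with $n$ cells, its descent set is the set of $i\in\{1,\dots,n-1\}$ such that $i+1$ lies in a column weakly to the right of that of $i$; $\mathrm{Des}(T)$ is the composition of $n$ whose set of partial sums (excluding $n$) is this set. Quasisymmetric functions. $QSym\subset\mathbb Q[[x_1,x_2,\dots]]$ has monomial basis $M_\alpha=\sum_\gamma\mathbf x^\gamma$ (over weak compositions $\gamma$ whose sequence of nonzero parts is $\alpha$) and fundamental basis $L_\alpha=\sum_{\beta}M_\beta$, the sum over compositions $\beta$ refining $\alpha$ (parts of $\alpha$ are sums of consecutive parts of $\beta$). The coproduct is $\Delta M_\alpha=\sum_{\beta\gamma=\alpha}M_\beta\otimes M_\gamma$ (concatenation). The quasisymmetric Schur functions $\mathcal S_\alpha=\sum_{T\in SSCT(\alpha/\!/\emptyset)}\mathbf x^{\mathrm{cont}(T)}$ form a basis of $QSym$. The skew quasisymmetric Schur functions $\mathcal S_{\gamma/\!/\beta}$ are defined by $\Delta\mathcal S_\gamma=\sum_\beta\mathcal S_{\gamma/\!/\beta}\otimes\mathcal S_\beta$, $\beta$ ranging over all compositions. *)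

theory Defs
  imports
    Complex_Main
    "HOL-Library.Poly_Mapping"
    "HOL-Library.Function_Algebras"
begin

section \<open>Compositions and diagrams\<close>

definition composition :: "nat list \<Rightarrow> bool" where
  "composition \<alpha> \<longleftrightarrow> (\<forall>a\<in>set \<alpha>. 0 < a)"

text \<open>Rows and columns are numbered from 0; row 0 is the top row and column 0 the first column.\<close>

definition diagram :: "nat list \<Rightarrow> (nat \<times> nat) set" where
  "diagram \<gamma> = {(i, k). i < length \<gamma> \<and> k < \<gamma> ! i}"

definition lower_left_contained :: "nat list \<Rightarrow> nat list \<Rightarrow> bool" where
  "lower_left_contained \<beta> \<gamma> \<longleftrightarrow> length \<beta> \<le> length \<gamma> \<and>
     (\<forall>i < length \<beta>. \<beta> ! (length \<beta> - Suc i) \<le> \<gamma> ! (length \<gamma> - Suc i))"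

text \<open>The cells of \<open>\<beta>\<close> once its diagram is placed in the lower left of that of \<open>\<gamma>\<close>.\<close>

definition inner_cells :: "nat list \<Rightarrow> nat list \<Rightarrow> (nat \<times> nat) set" where
  "inner_cells \<gamma> \<beta> = (\<lambda>(i, k). (i + (length \<gamma> - length \<beta>), k)) ` diagram \<beta>"

definition skew_cells :: "nat list \<Rightarrow> nat list \<Rightarrow> (nat \<times> nat) set" where
  "skew_cells \<gamma> \<beta> = diagram \<gamma> - inner_cells \<gamma> \<beta>"

section \<open>Composition tableaux\<close>

definition attacks :: "nat list \<Rightarrow> nat list \<Rightarrow> nat \<times> nat \<Rightarrow> nat \<times> nat \<Rightarrow> bool" where
  "attacks \<gamma> \<beta> c d \<longleftrightarrow> (\<exists>i j k. c = (i, k) \<and> d = (j, Suc k) \<and> i < j \<and>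
     (j, Suc k) \<in> skew_cells \<gamma> \<beta> \<and> (i, Suc k) \<notin> inner_cells \<gamma> \<beta>)"

text \<open>A filling is a function on all of \<open>nat \<times> nat\<close> that is positive on the cells of the shape and
  takes the junk value 0 elsewhere, so that distinct functions are distinct fillings.\<close>

definition SSCT :: "nat list \<Rightarrow> nat list \<Rightarrow> (nat \<times> nat \<Rightarrow> nat) set" where
  "SSCT \<gamma> \<beta> = {T. lower_left_contained \<beta> \<gamma> \<and>
     (\<forall>c \<in> skew_cells \<gamma> \<beta>. 0 < T c) \<and> (\<forall>c. c \<notin> skew_cells \<gamma> \<beta> \<longrightarrow> T c = 0) \<and>
     (\<forall>i k k'. (i, k) \<in> skew_cells \<gamma> \<beta> \<and> (i, k') \<in> skew_cells \<gamma> \<beta> \<and> k < k' \<longrightarrow> T (i, k') \<le> T (i, k)) \<and>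
     (\<forall>i j. (i, 0) \<in> skew_cells \<gamma> \<beta> \<and> (j, 0) \<in> skew_cells \<gamma> \<beta> \<and> i < j \<longrightarrow> T (i, 0) < T (j, 0)) \<and>
     (\<forall>i j k. (i, k) \<in> diagram \<gamma> \<and> attacks \<gamma> \<beta> (i, k) (j, Suc k) \<and>
        ((i, k) \<in> inner_cells \<gamma> \<beta> \<or> T (j, Suc k) \<le> T (i, k)) \<longrightarrow>
        (i, Suc k) \<in> skew_cells \<gamma> \<beta> \<and> T (j, Suc k) < T (i, Suc k))}"

definition SCT :: "nat list \<Rightarrow> nat list \<Rightarrow> (nat \<times> nat \<Rightarrow> nat) set" where
  "SCT \<gamma> \<beta> = {T \<in> SSCT \<gamma> \<beta>. bij_betw T (skew_cells \<gamma> \<beta>) {1..sum_list \<gamma> - sum_list \<beta>}}"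

text \<open>A weak composition, up to trailing zeros, is a finitely supported function; position \<open>i\<close>
  holds part number \<open>i + 1\<close>, that is, the exponent of $x_{i+1}$.\<close>

definition cont :: "(nat \<times> nat \<Rightarrow> nat) \<Rightarrow> (nat \<Rightarrow>\<^sub>0 nat)" where
  "cont T = Abs_poly_mapping (\<lambda>i. card {c. T c = Suc i})"

definition num_cells :: "(nat \<times> nat \<Rightarrow> nat) \<Rightarrow> nat" where
  "num_cells T = card {c. T c \<noteq> 0}"

definition descents :: "(nat \<times> nat \<Rightarrow> nat) \<Rightarrow> nat set" where
  "descents T = {i. 1 \<le> i \<and> i < num_cells T \<and>
     (\<exists>r c r' c'. T (r, c) = i \<and> T (r', c') = Suc i \<and> c \<le> c')}"

definition Des :: "(nat \<times> nat \<Rightarrow> nat) \<Rightarrow> nat list" where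
  "Des T = (THE \<alpha>. composition \<alpha> \<and> sum_list \<alpha> = num_cells T \<and>
     {sum_list (take k \<alpha>) | k. 1 \<le> k \<and> k \<le> length \<alpha>} - {num_cells T} = descents T)"

section \<open>Formal power series over the rationals in countably many variables\<close>

text \<open>A series is its coefficient function. Only the pointwise additive structure of function spaces
  is used below, never their pointwise multiplication.\<close>

type_synonym series = "(nat \<Rightarrow>\<^sub>0 nat) \<Rightarrow> rat"

definition scale :: "rat \<Rightarrow> ('a \<Rightarrow> rat) \<Rightarrow> 'a \<Rightarrow> rat" where
  "scale c f = (\<lambda>w. c * f w)"

interpretation ser: vector_space scale
  by unfold_locales (auto simp: scale_def fun_eq_iff algebra_simps)

definition monom :: "(nat \<Rightarrow>\<^sub>0 nat) \<Rightarrow> series" where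
  "monom \<tau> = (\<lambda>w. if w = \<tau> then 1 else 0)"

text \<open>Coefficientwise sum of a family of series, possibly infinite, in which each monomial occurs
  in only finitely many members.\<close>

definition formal_sum :: "('t \<Rightarrow> series) \<Rightarrow> 't set \<Rightarrow> series" where
  "formal_sum F A = (\<lambda>w. \<Sum>t \<in> {t \<in> A. F t w \<noteq> 0}. F t w)"

section \<open>Quasisymmetric functions\<close>

definition nonzero_parts :: "(nat \<Rightarrow>\<^sub>0 nat) \<Rightarrow> nat list" where
  "nonzero_parts w = map (Poly_Mapping.lookup w) (sorted_list_of_set (Poly_Mapping.keys w))"

definition M :: "nat list \<Rightarrow> series" where
  "M \<alpha> = formal_sum monom {w. nonzero_parts w = \<alpha>}"

definition refines :: "nat list \<Rightarrow> nat list \<Rightarrow> bool" where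
  "refines \<beta> \<alpha> \<longleftrightarrow> (\<exists>blocks. concat blocks = \<beta> \<and> map sum_list blocks = \<alpha>)"

definition L :: "nat list \<Rightarrow> series" where
  "L \<alpha> = (\<Sum>\<beta> \<in> {\<beta>. composition \<beta> \<and> refines \<beta> \<alpha>}. M \<beta>)"

definition QSym :: "series set" where
  "QSym = ser.span (M ` {\<alpha>. composition \<alpha>})"

text \<open>Tensors are realised as series in two sets of variables:
  \<open>f \<otimes> g\<close> is the product $f(x)\,g(y)$. The induced map from \<open>QSym \<otimes> QSym\<close> is injective.\<close>

definition tensor :: "series \<Rightarrow> series \<Rightarrow> (nat \<Rightarrow>\<^sub>0 nat) \<times> (nat \<Rightarrow>\<^sub>0 nat) \<Rightarrow> rat" where
  "tensor f g = (\<lambda>(u, v). f u * g v)"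

definition M_coeff :: "series \<Rightarrow> nat list \<Rightarrow> rat" where
  "M_coeff f \<alpha> = ser.representation (M ` {\<alpha>. composition \<alpha>}) f (M \<alpha>)"

text \<open>The linear extension to \<open>QSym\<close> of the coproduct given on the monomial basis.\<close>

definition coproduct :: "series \<Rightarrow> (nat \<Rightarrow>\<^sub>0 nat) \<times> (nat \<Rightarrow>\<^sub>0 nat) \<Rightarrow> rat" where
  "coproduct f = (\<Sum>\<alpha> \<in> {\<alpha>. composition \<alpha> \<and> M_coeff f \<alpha> \<noteq> 0}.
     scale (M_coeff f \<alpha>) (\<Sum>(\<beta>, \<gamma>) \<in> {(\<beta>, \<gamma>). \<beta> @ \<gamma> = \<alpha>}. tensor (M \<beta>) (M \<gamma>)))"

definition QS :: "nat list \<Rightarrow> series" where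
  "QS \<alpha> = formal_sum (\<lambda>T. monom (cont T)) (SSCT \<alpha> [])"

text \<open>The family of left tensor factors in the expansion of the coproduct of \<open>QS \<gamma>\<close>. As
  the \<open>QS \<beta>\<close> form a basis of \<open>QSym\<close>, it exists and is unique (on compositions).\<close>

definition is_skew_family :: "nat list \<Rightarrow> (nat list \<Rightarrow> series) \<Rightarrow> bool" where
  "is_skew_family \<gamma> s \<longleftrightarrow>
     (\<forall>\<beta>. composition \<beta> \<longrightarrow> s \<beta> \<in> QSym) \<and>
     finite {\<beta>. composition \<beta> \<and> s \<beta> \<noteq> 0} \<and>
     coproduct (QS \<gamma>) = (\<Sum>\<beta> \<in> {\<beta>. composition \<beta> \<and> s \<beta> \<noteq> 0}. tensor (s \<beta>) (QS \<beta>))"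

definition skew_QS :: "nat list \<Rightarrow> nat list \<Rightarrow> series" where
  "skew_QS \<gamma> \<beta> = (THE f. \<exists>s. is_skew_family \<gamma> s \<and> f = s \<beta>)"

end

theory Submission
  imports Defs "HOL-Library.List_Lexorder"
begin

text \<open>
  Both equalities are statements about coefficients. The coefficient of \<open>x\<^bsup>w\<^esup>\<close> in the sum over
  \<open>SSCT \<gamma> \<beta>\<close> is the number of tableaux of content \<open>w\<close>, and its coefficient in \<open>L \<alpha>\<close> is
  \<open>1\<close> or \<open>0\<close> according to whether the nonzero parts of \<open>w\<close> refine \<open>\<alpha>\<close>.

  The second equality is standardization. Equal entries of a semistandard tableau lie in different
  columns (\<open>SSCT_column_distinct\<close>), so renumbering equal entries from right to left gives a
  standard tableau, which satisfies the defining conditions because these only compare entries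
  (\<open>SSCT_standardization_iff\<close>). A standard tableau \<open>U\<close> arises from a semistandard tableau of
  content \<open>w\<close> exactly when every descent of \<open>U\<close> is a partial sum of the nonzero parts of \<open>w\<close>, and
  then from exactly one (\<open>bij_betw_relabel\<close>). As refinement of compositions is inclusion of their
  sets of partial sums, this is the condition that \<open>x\<^bsup>w\<^esup>\<close> occurs in \<open>L (Des U)\<close>. In particular the
  series is quasisymmetric.

  For the first equality, the coproduct of a quasisymmetric function is its evaluation at an
  alphabet \<open>x\<close> followed by an alphabet \<open>y\<close> (\<open>coproduct_apply_join\<close>). In a tableau of
  shape \<open>\<gamma>\<close> over the two alphabets, the letters from \<open>y\<close> are the large ones. Rows decrease
  and the first column increases, so these letters fill the diagram of a composition \<open>\<beta>\<close> in the
  lower left corner (\<open>ex_shape_of_large_entries\<close>). They form a tableau of shape \<open>\<beta>\<close>, the remaining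
  entries form one of shape \<open>\<gamma>//\<beta>\<close>, and any such pair of tableaux can be glued
  (\<open>bij_betw_split\<close>). So the sums over \<open>SSCT \<gamma> \<beta>\<close> are a family of left factors in the
  expansion of the coproduct of \<open>QS \<gamma>\<close>.

  The expansion determines its left factors because the \<open>QS \<beta>\<close> are linearly independent
  (\<open>QS_independent\<close>). The largest letter of a tableau of composition shape can only occupy an
  initial segment of the last row, and deleting the last row leaves a tableau. Hence a tableau of
  shape \<open>\<delta>\<close> whose content is the composition \<open>\<alpha>\<close> satisfies \<open>\<alpha> \<le> \<delta>\<close> when parts are
  compared lexicographically from the last one backwards, which makes the expansion of the
  \<open>QS \<delta>\<close> in monomial functions triangular.
\<close>

section \<open>Compositions and their partial sums\<close>

lemma composition_Cons [simp]: "composition (a # \<alpha>) \<longleftrightarrow> 0 < a \<and> composition \<alpha>"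
  by (auto simp: composition_def)

lemma composition_append [simp]: "composition (\<alpha> @ \<beta>) \<longleftrightarrow> composition \<alpha> \<and> composition \<beta>"
  by (auto simp: composition_def)

lemma composition_Nil [simp]: "composition []"
  by (auto simp: composition_def)

definition partial_sums :: "nat list \<Rightarrow> nat set" where
  "partial_sums \<alpha> = {sum_list (take k \<alpha>) | k. 1 \<le> k \<and> k \<le> length \<alpha>}"

lemma partial_sums_Nil [simp]: "partial_sums [] = {}"
  by (auto simp: partial_sums_def)

lemma partial_sums_Cons: "partial_sums (a # \<alpha>) = insert a ((+) a ` partial_sums \<alpha>)"
proof (rule set_eqI)
  fix x
  show "x \<in> partial_sums (a # \<alpha>) \<longleftrightarrow> x \<in> insert a ((+) a ` partial_sums \<alpha>)" (is "?l \<longleftrightarrow> ?r")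
  proof
    assume ?l
    then obtain k where k: "x = sum_list (take k (a # \<alpha>))" "1 \<le> k" "k \<le> length (a # \<alpha>)"
      by (auto simp: partial_sums_def)
    show ?r
    proof (cases "k = 1")
      case False
      with k have "sum_list (take (k - 1) \<alpha>) \<in> partial_sums \<alpha>" "x = a + sum_list (take (k - 1) \<alpha>)"
        by (auto simp: partial_sums_def take_Cons')
      then show ?thesis by blast
    qed (use k in auto)
  next
    assume ?r
    then consider "x = a" | k where "x = a + sum_list (take k \<alpha>)" "1 \<le> k" "k \<le> length \<alpha>"
      by (auto simp: partial_sums_def)
    then show ?l
    proof cases
      case 1
      then show ?thesis by (auto simp: partial_sums_def intro!: exI[of _ 1])
    next
      case 2
      then show ?thesis by (auto simp: partial_sums_def intro!: exI[of _ "Suc k"])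
    qed
  qed
qed

lemma partial_sums_append:
  "partial_sums (\<alpha> @ \<beta>) = partial_sums \<alpha> \<union> (+) (sum_list \<alpha>) ` partial_sums \<beta>"
  by (induction \<alpha>) (auto simp: partial_sums_Cons image_Un image_image add.assoc)

lemma partial_sums_le: "p \<in> partial_sums \<alpha> \<Longrightarrow> p \<le> sum_list \<alpha>"
  by (induction \<alpha> arbitrary: p) (auto simp: partial_sums_Cons)

lemma partial_sums_pos: "composition \<alpha> \<Longrightarrow> p \<in> partial_sums \<alpha> \<Longrightarrow> 0 < p"
  by (induction \<alpha> arbitrary: p) (auto simp: partial_sums_Cons composition_def)

lemma sum_list_in_partial_sums: "\<alpha> \<noteq> [] \<Longrightarrow> sum_list \<alpha> \<in> partial_sums \<alpha>"
  by (auto simp: partial_sums_def Suc_le_eq intro!: exI[of _ "length \<alpha>"])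

lemma composition_sum_list_0: "composition \<alpha> \<Longrightarrow> sum_list \<alpha> = 0 \<longleftrightarrow> \<alpha> = []"
  by (cases \<alpha>) auto

lemma refines_Nil: "refines \<beta> [] \<longleftrightarrow> \<beta> = []"
  by (auto simp: refines_def)

lemma refines_Cons:
  "refines \<beta> (a # \<alpha>) \<longleftrightarrow> (\<exists>b1 b2. \<beta> = b1 @ b2 \<and> sum_list b1 = a \<and> refines b2 \<alpha>)" (is "?l \<longleftrightarrow> ?r")
proof
  assume ?l
  then obtain blocks where "concat blocks = \<beta>" "map sum_list blocks = a # \<alpha>"
    unfolding refines_def by (elim exE conjE)
  then show ?r unfolding refines_def by (intro exI[of _ "hd blocks"] exI[of _ "concat (tl blocks)"])
    (cases blocks; auto)
next
  assume ?r
  then obtain b1 b2 where b: "\<beta> = b1 @ b2" "sum_list b1 = a" "refines b2 \<alpha>"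
    by (elim exE conjE)
  from b(3) obtain blocks where "concat blocks = b2" "map sum_list blocks = \<alpha>"
    unfolding refines_def by (elim exE conjE)
  with b show ?l unfolding refines_def by (intro exI[of _ "b1 # blocks"]) simp
qed

lemma refines_sum_list: "refines \<beta> \<alpha> \<Longrightarrow> sum_list \<beta> = sum_list \<alpha>"
  by (induction \<alpha> arbitrary: \<beta>) (auto simp: refines_Nil refines_Cons)

lemma refines_imp_partial_sums:
  "composition \<alpha> \<Longrightarrow> refines \<beta> \<alpha> \<Longrightarrow> partial_sums \<alpha> \<subseteq> partial_sums \<beta>"
proof (induction \<alpha> arbitrary: \<beta>)
  case (Cons a \<alpha>)
  then obtain b1 b2 where b: "\<beta> = b1 @ b2" "sum_list b1 = a" "refines b2 \<alpha>"
    by (auto simp: refines_Cons)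
  with Cons.prems have "b1 \<noteq> []" by auto
  then have "a \<in> partial_sums b1" using sum_list_in_partial_sums b by blast
  moreover have "partial_sums \<alpha> \<subseteq> partial_sums b2" using Cons b by auto
  ultimately show ?case using b by (auto simp: partial_sums_Cons partial_sums_append)
qed auto

text \<open>The first part \<open>a\<close> of \<open>\<alpha>\<close> is a partial sum of \<open>\<beta>\<close>, so \<open>\<beta>\<close> begins with a block of sum \<open>a\<close>.
  The other partial sums of \<open>\<alpha>\<close> exceed \<open>a\<close>, so they come from the rest of \<open>\<beta>\<close>, to which the induction
  hypothesis applies.\<close>

lemma partial_sums_imp_refines:
  assumes "composition \<alpha>" "composition \<beta>" "sum_list \<beta> = sum_list \<alpha>"
    "partial_sums \<alpha> \<subseteq> partial_sums \<beta>"
  shows "refines \<beta> \<alpha>"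
  using assms
proof (induction \<alpha> arbitrary: \<beta>)
  case Nil
  then show ?case by (simp add: refines_Nil composition_sum_list_0 del: sum_list_eq_0_iff)
next
  case (Cons a \<alpha>)
  have "a \<in> partial_sums \<beta>" using Cons.prems by (auto simp: partial_sums_Cons)
  then obtain k where k: "a = sum_list (take k \<beta>)" by (auto simp: partial_sums_def)
  define b1 b2 where "b1 = take k \<beta>" and "b2 = drop k \<beta>"
  have b: "\<beta> = b1 @ b2" "sum_list b1 = a" using k by (auto simp: b1_def b2_def)
  have "p \<in> partial_sums b2" if p: "p \<in> partial_sums \<alpha>" for p
  proof -
    have "a + p \<in> partial_sums \<beta>" using Cons.prems p by (auto simp: partial_sums_Cons)
    moreover have "a + p \<notin> partial_sums b1"
      using partial_sums_le[of "a + p" b1] partial_sums_pos[of \<alpha> p] Cons.prems p b by auto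
    ultimately show ?thesis using b by (auto simp: partial_sums_append)
  qed
  then have "refines b2 \<alpha>" using Cons b by (intro Cons.IH) auto
  then show ?case using b by (auto simp: refines_Cons)
qed

text \<open>This turns membership of a monomial in a fundamental function into a condition on descent
  sets.\<close>

lemma refines_iff_partial_sums:
  assumes "composition \<alpha>" "composition \<beta>" "sum_list \<beta> = sum_list \<alpha>"
  shows "refines \<beta> \<alpha> \<longleftrightarrow> partial_sums \<alpha> \<subseteq> partial_sums \<beta>"
  using assms refines_imp_partial_sums partial_sums_imp_refines by blast

lemma partial_sums_inject:
  assumes "composition \<alpha>" "composition \<beta>" "partial_sums \<alpha> = partial_sums \<beta>"
  shows "\<alpha> = \<beta>"
  using assms
proof (induction \<alpha> arbitrary: \<beta>)
  case Nil
  then show ?case by (cases \<beta>) (auto simp: partial_sums_Cons)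
next
  case (Cons a \<alpha>)
  then obtain b \<beta>' where [simp]: "\<beta> = b # \<beta>'" by (cases \<beta>) (auto simp: partial_sums_Cons)
  note eq = Cons.prems(3)[unfolded \<open>\<beta> = b # \<beta>'\<close> partial_sums_Cons]
  have [simp]: "a = b"
  proof (rule antisym)
    show "a \<le> b" using eq by auto
    show "b \<le> a" using eq by auto
  qed
  have "b \<notin> (+) b ` partial_sums \<alpha>" "b \<notin> (+) b ` partial_sums \<beta>'"
    using Cons.prems partial_sums_pos by fastforce+
  with eq have "(+) b ` partial_sums \<alpha> = (+) b ` partial_sums \<beta>'"
    by (simp only: insert_ident \<open>a = b\<close> not_False_eq_True)
  then have "partial_sums \<alpha> = partial_sums \<beta>'" by (simp add: inj_image_eq_iff)
  then show ?case using Cons by auto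
qed

text \<open>Induction on \<open>n\<close>: the largest element \<open>m\<close> of \<open>S\<close> splits off a last part \<open>n - m\<close>.\<close>

lemma ex_composition_partial_sums:
  "S \<subseteq> {1..<n} \<Longrightarrow> \<exists>\<alpha>. composition \<alpha> \<and> sum_list \<alpha> = n \<and> partial_sums \<alpha> - {n} = S"
proof (induction n arbitrary: S rule: less_induct)
  case (less n)
  consider "n = 0" | "0 < n" "S = {}" | "S \<noteq> {}" by blast
  then show ?case
  proof cases
    case 1
    then show ?thesis using less.prems by (intro exI[of _ "[]"]) auto
  next
    case 2
    then show ?thesis by (intro exI[of _ "[n]"]) (auto simp: partial_sums_Cons)
  next
    case 3
    have fin: "finite S" using less.prems finite_subset by blast
    define m where "m = Max S"
    have m: "m \<in> S" "\<And>x. x \<in> S \<Longrightarrow> x \<le> m" using 3 fin by (auto simp: m_def)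
    then have mn: "1 \<le> m" "m < n" using less.prems by auto
    have "S - {m} \<subseteq> {1..<m}" using m less.prems by fastforce
    from less.IH[OF mn(2) this] obtain \<alpha> where
      \<alpha>: "composition \<alpha>" "sum_list \<alpha> = m" "partial_sums \<alpha> - {m} = S - {m}" by auto
    have "m \<in> partial_sums \<alpha>"
      using \<alpha>(2) mn(1) sum_list_in_partial_sums[of \<alpha>] by (cases "\<alpha> = []") auto
    then have "partial_sums \<alpha> = S" using \<alpha>(3) m(1) by auto
    then show ?thesis using \<alpha> mn less.prems
      by (intro exI[of _ "\<alpha> @ [n - m]"]) (auto simp: partial_sums_append partial_sums_Cons)
  qed
qed

text \<open>The total \<open>n\<close> is a partial sum of every nonempty composition of \<open>n\<close>, so it may be ignored when
  partial sums are compared; for \<open>n = 0\<close> both compositions are empty.\<close>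

lemma partial_sums_minus_total:
  assumes "composition \<alpha>" "composition \<beta>" "sum_list \<alpha> = n" "sum_list \<beta> = n"
    "partial_sums \<alpha> - {n} \<subseteq> partial_sums \<beta>"
  shows "partial_sums \<alpha> \<subseteq> partial_sums \<beta>"
proof (cases "\<beta> = []")
  case True
  then show ?thesis using assms composition_sum_list_0[of \<alpha>] by auto
next
  case False
  then show ?thesis using assms sum_list_in_partial_sums[of \<beta>] by auto
qed

text \<open>The definite description in \<open>Des\<close> denotes: compositions of \<open>n\<close> correspond to subsets of
  \<open>{1..<n}\<close>.\<close>

lemma Des_properties:
  shows "composition (Des T)" and "sum_list (Des T) = num_cells T"
    and "partial_sums (Des T) - {num_cells T} = descents T"
proof -
  let ?P = "\<lambda>\<alpha>. composition \<alpha> \<and> sum_list \<alpha> = num_cells T \<and>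
     partial_sums \<alpha> - {num_cells T} = descents T"
  have ex: "\<exists>\<alpha>. ?P \<alpha>" by (rule ex_composition_partial_sums) (auto simp: descents_def)
  have uniq: "\<alpha> = \<beta>" if "?P \<alpha>" "?P \<beta>" for \<alpha> \<beta>
    using that by (intro partial_sums_inject subset_antisym partial_sums_minus_total) auto
  have "?P (THE \<alpha>. ?P \<alpha>)" by (rule theI', rule ex_ex1I[OF ex uniq])
  moreover have "Des T = (THE \<alpha>. ?P \<alpha>)" by (simp only: Des_def partial_sums_def)
  ultimately have "?P (Des T)" by (simp only:)
  then show "composition (Des T)" "sum_list (Des T) = num_cells T"
    "partial_sums (Des T) - {num_cells T} = descents T" by auto
qed

lemma refines_Des_iff:
  assumes "composition \<beta>"
  shows "refines \<beta> (Des T) \<longleftrightarrow> sum_list \<beta> = num_cells T \<and> descents T \<subseteq> partial_sums \<beta>"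
proof (cases "sum_list \<beta> = num_cells T")
  case True
  have "partial_sums (Des T) \<subseteq> partial_sums \<beta> \<longleftrightarrow> descents T \<subseteq> partial_sums \<beta>"
    using Des_properties[of T] True assms partial_sums_minus_total[of "Des T" \<beta> "num_cells T"] by blast
  then show ?thesis using True assms Des_properties[of T] refines_iff_partial_sums[of "Des T" \<beta>] by auto
next
  case False
  then show ?thesis using refines_sum_list[of \<beta> "Des T"] Des_properties[of T] by auto
qed

section \<open>Weak compositions\<close>

lemma composition_nonzero_parts: "composition (nonzero_parts w)"
proof -
  have "set (sorted_list_of_set (Poly_Mapping.keys w)) = Poly_Mapping.keys w" by simp
  then show ?thesis by (auto simp: composition_def nonzero_parts_def in_keys_iff)
qed

lemma nonzero_parts_eq_filter:
  assumes "Poly_Mapping.keys w \<subseteq> {..<N}"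
  shows "nonzero_parts w = filter (\<lambda>x. x \<noteq> 0) (map (Poly_Mapping.lookup w) [0..<N])"
proof -
  let ?xs = "filter (\<lambda>i. Poly_Mapping.lookup w i \<noteq> 0) [0..<N]"
  have "set ?xs = Poly_Mapping.keys w" using assms by (auto simp: in_keys_iff)
  moreover have "sorted_list_of_set (set ?xs) = ?xs"
    by (rule sorted_list_of_set.idem_if_sorted_distinct) (auto simp: sorted_wrt_filter)
  ultimately show ?thesis by (simp add: nonzero_parts_def filter_map comp_def)
qed

lemma partial_sums_filter: "partial_sums (filter (\<lambda>x. x \<noteq> 0) xs) = partial_sums xs - {0}"
proof (induction xs)
  case (Cons a xs)
  have "insert a ((+) a ` (S - {0})) = insert a ((+) a ` S)" for S :: "nat set"
  proof
    show "insert a ((+) a ` S) \<subseteq> insert a ((+) a ` (S - {0}))"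
    proof
      fix x assume "x \<in> insert a ((+) a ` S)"
      then consider "x = a" | s where "x = a + s" "s \<in> S" by blast
      then show "x \<in> insert a ((+) a ` (S - {0}))" by cases (auto simp: image_iff)
    qed
  qed blast
  moreover have "0 \<notin> insert a ((+) a ` S)" if "a \<noteq> 0" for S :: "nat set"
    using that by auto
  ultimately show ?case using Cons.IH
    by (cases "a = 0") (simp_all add: partial_sums_Cons del: neq0_conv)
qed simp

text \<open>The number of entries at most \<open>i\<close> in a filling of content \<open>w\<close>, as position \<open>j\<close> of \<open>w\<close> counts
  the entries \<open>j + 1\<close>.\<close>

definition weight_below :: "(nat \<Rightarrow>\<^sub>0 nat) \<Rightarrow> nat \<Rightarrow> nat" where
  "weight_below w i = (\<Sum>j<i. Poly_Mapping.lookup w j)"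

lemma weight_below_mono: "i \<le> j \<Longrightarrow> weight_below w i \<le> weight_below w j"
  unfolding weight_below_def by (intro sum_mono2) auto

lemma weight_below_Suc: "weight_below w (Suc i) = weight_below w i + Poly_Mapping.lookup w i"
  by (simp add: weight_below_def)

lemma weight_below_0 [simp]: "weight_below w 0 = 0"
  by (simp add: weight_below_def)

lemma weight_below_beyond_keys:
  assumes "Poly_Mapping.keys w \<subseteq> {..<N}" "N \<le> i"
  shows "weight_below w i = weight_below w N"
  unfolding weight_below_def using assms
  by (intro sum.mono_neutral_right) (auto simp: in_keys_iff)

lemma ex_keys_bound: "\<exists>N. Poly_Mapping.keys (w :: nat \<Rightarrow>\<^sub>0 nat) \<subseteq> {..<N}"
  using finite_nat_set_iff_bounded[of "Poly_Mapping.keys w"] by auto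

lemma sum_list_take_lookup:
  "k \<le> N \<Longrightarrow> sum_list (take k (map (Poly_Mapping.lookup w) [0..<N])) = weight_below w k"
  by (simp add: take_map take_upt weight_below_def interv_sum_list_conv_sum_set_nat
      lessThan_atLeast0)

lemma sum_list_filter_nonzero: "sum_list (filter (\<lambda>x. x \<noteq> 0) xs) = sum_list (xs :: nat list)"
  by (induction xs) auto

lemma sum_list_nonzero_parts:
  assumes "Poly_Mapping.keys w \<subseteq> {..<N}"
  shows "sum_list (nonzero_parts w) = weight_below w N"
  unfolding nonzero_parts_eq_filter[OF assms] sum_list_filter_nonzero
  using sum_list_take_lookup[of N N w] by simp

lemma partial_sums_nonzero_parts: "partial_sums (nonzero_parts w) = range (weight_below w) - {0}"
proof -
  obtain N where N: "Poly_Mapping.keys w \<subseteq> {..<N}" using ex_keys_bound by blast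
  have "partial_sums (map (Poly_Mapping.lookup w) [0..<N]) = weight_below w ` {1..N}"
  proof -
    have "partial_sums (map (Poly_Mapping.lookup w) [0..<N]) =
        (\<lambda>k. sum_list (take k (map (Poly_Mapping.lookup w) [0..<N]))) ` {1..N}"
      unfolding partial_sums_def by auto
    also have "\<dots> = weight_below w ` {1..N}"
      by (intro image_cong refl sum_list_take_lookup) simp
    finally show ?thesis .
  qed
  moreover have "range (weight_below w) - {0} = weight_below w ` {1..N} - {0}"
  proof -
    have "weight_below w i \<in> weight_below w ` {1..N}" if pos: "weight_below w i \<noteq> 0" for i
    proof -
      have "weight_below w i = weight_below w (min i N)"
        using weight_below_beyond_keys[OF N, of i] by (cases "i \<le> N") (simp_all add: min_def)
      moreover from this pos have "min i N \<noteq> 0" by (intro notI) simp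
      ultimately show ?thesis by (intro image_eqI[where x = "min i N"]) simp_all
    qed
    then show ?thesis by blast
  qed
  ultimately show ?thesis
    by (simp only: nonzero_parts_eq_filter[OF N] partial_sums_filter)
qed

text \<open>Every composition is the sequence of nonzero parts of some exponent, so coefficients at such
  exponents separate the monomial functions.\<close>

lemma nonzero_parts_nth:
  assumes "composition \<alpha>"
  shows "nonzero_parts (Poly_Mapping.nth \<alpha>) = \<alpha>"
proof -
  have keys: "Poly_Mapping.keys (Poly_Mapping.nth \<alpha>) \<subseteq> {..<length \<alpha>}"
  proof
    fix i assume "i \<in> Poly_Mapping.keys (Poly_Mapping.nth \<alpha>)"
    then have "Poly_Mapping.lookup (Poly_Mapping.nth \<alpha>) i \<noteq> 0" by (rule iffD1[OF in_keys_iff])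
    then have "nth_default 0 \<alpha> i \<noteq> 0" unfolding lookup_nth .
    then show "i \<in> {..<length \<alpha>}" by (simp add: nth_default_def split: if_splits)
  qed
  have map: "map (Poly_Mapping.lookup (Poly_Mapping.nth \<alpha>)) [0..<length \<alpha>] = \<alpha>"
    by (rule nth_equalityI) (simp_all add: nth_default_def)
  show ?thesis using assms
    unfolding nonzero_parts_eq_filter[OF keys] map composition_def filter_id_conv by auto
qed

text \<open>The weak composition \<open>u\<close>, padded to length \<open>N\<close>, followed by \<open>v\<close>.\<close>

definition join :: "nat \<Rightarrow> (nat \<Rightarrow>\<^sub>0 nat) \<Rightarrow> (nat \<Rightarrow>\<^sub>0 nat) \<Rightarrow> (nat \<Rightarrow>\<^sub>0 nat)" where
  "join N u v = Abs_poly_mapping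
     (\<lambda>i. if i < N then Poly_Mapping.lookup u i else Poly_Mapping.lookup v (i - N))"

lemma lookup_join:
  "Poly_Mapping.lookup (join N u v) i =
     (if i < N then Poly_Mapping.lookup u i else Poly_Mapping.lookup v (i - N))"
proof -
  obtain K where K: "Poly_Mapping.keys v \<subseteq> {..<K}" using ex_keys_bound by blast
  have "i < N + K" if "(if i < N then Poly_Mapping.lookup u i else Poly_Mapping.lookup v (i - N)) \<noteq> 0" for i
  proof (cases "i < N")
    case False
    with that have "i - N \<in> Poly_Mapping.keys v" by (simp add: in_keys_iff)
    then have "i - N < K" using K by blast
    then show ?thesis by simp
  qed simp
  then have "{i. (if i < N then Poly_Mapping.lookup u i else Poly_Mapping.lookup v (i - N)) \<noteq> 0} \<subseteq> {..<N + K}"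
    by blast
  then have "finite {i. (if i < N then Poly_Mapping.lookup u i else Poly_Mapping.lookup v (i - N)) \<noteq> 0}"
    using finite_subset by blast
  then show ?thesis by (simp add: join_def Abs_poly_mapping_inverse)
qed

lemma nonzero_parts_join:
  assumes "Poly_Mapping.keys u \<subseteq> {..<N}"
  shows "nonzero_parts (join N u v) = nonzero_parts u @ nonzero_parts v"
proof -
  obtain K where K: "Poly_Mapping.keys v \<subseteq> {..<K}" using ex_keys_bound by blast
  have keys: "Poly_Mapping.keys (join N u v) \<subseteq> {..<N + K}"
  proof
    fix i assume i: "i \<in> Poly_Mapping.keys (join N u v)"
    show "i \<in> {..<N + K}"
    proof (cases "i < N")
      case False
      with i have "i - N \<in> Poly_Mapping.keys v" by (simp add: in_keys_iff lookup_join)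
      then have "i - N < K" using K by blast
      then show ?thesis by simp
    qed simp
  qed
  have map: "map (Poly_Mapping.lookup (join N u v)) [0..<N + K] =
      map (Poly_Mapping.lookup u) [0..<N] @ map (Poly_Mapping.lookup v) [0..<K]"
    by (rule nth_equalityI) (auto simp: nth_append lookup_join)
  show ?thesis
    unfolding nonzero_parts_eq_filter[OF assms] nonzero_parts_eq_filter[OF K]
      nonzero_parts_eq_filter[OF keys] map by (rule filter_append)
qed

section \<open>Coefficients of quasisymmetric functions\<close>

lemma sum_fun_apply: "(\<Sum>a\<in>A. f a) x = (\<Sum>a\<in>A. (f a x :: 'b :: comm_monoid_add))"
  by (induction A rule: infinite_finite_induct) auto

lemma formal_sum_monom_apply:
  "formal_sum (\<lambda>T. monom (g T)) A w = of_nat (card {T \<in> A. g T = w})"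
proof -
  have "{T \<in> A. monom (g T) w \<noteq> 0} = {T \<in> A. g T = w}" by (auto simp: monom_def)
  moreover have "(\<Sum>T \<in> {T \<in> A. g T = w}. monom (g T) w) = (\<Sum>T \<in> {T \<in> A. g T = w}. 1)"
    by (intro sum.cong) (auto simp: monom_def)
  ultimately show ?thesis by (simp add: formal_sum_def)
qed

lemma M_apply: "M \<alpha> w = (if nonzero_parts w = \<alpha> then 1 else 0)"
proof -
  have "M \<alpha> w = of_nat (card {v \<in> {w. nonzero_parts w = \<alpha>}. v = w})"
    unfolding M_def using formal_sum_monom_apply[of "\<lambda>v. v"] by simp
  also have "{v \<in> {w. nonzero_parts w = \<alpha>}. v = w} = (if nonzero_parts w = \<alpha> then {w} else {})"
    by auto
  finally show ?thesis by simp
qed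

lemma length_le_sum_list_composition: "composition \<alpha> \<Longrightarrow> length \<alpha> \<le> sum_list \<alpha>"
  by (induction \<alpha>) auto

lemma finite_compositions: "finite {\<alpha>. composition \<alpha> \<and> sum_list \<alpha> = n}"
proof (rule finite_subset)
  show "{\<alpha>. composition \<alpha> \<and> sum_list \<alpha> = n} \<subseteq> {xs. set xs \<subseteq> {..n} \<and> length xs \<le> n}"
    using length_le_sum_list_composition member_le_sum_list by fastforce
qed (simp add: finite_lists_length_le)

lemma finite_refining: "finite {\<beta>. composition \<beta> \<and> refines \<beta> \<alpha>}"
  using refines_sum_list by (intro finite_subset[OF _ finite_compositions[of "sum_list \<alpha>"]]) blast

lemma L_apply: "L \<alpha> w = (if refines (nonzero_parts w) \<alpha> then 1 else 0)"
proof -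
  have "L \<alpha> w = (\<Sum>\<beta> | composition \<beta> \<and> refines \<beta> \<alpha>. if nonzero_parts w = \<beta> then 1 else 0)"
    unfolding L_def sum_fun_apply M_apply ..
  then show ?thesis using finite_refining composition_nonzero_parts by simp
qed

lemma L_in_QSym: "L \<alpha> \<in> QSym"
  unfolding L_def QSym_def by (intro ser.span_sum ser.span_base imageI) auto

lemma inj_on_M: "inj_on M {\<alpha>. composition \<alpha>}"
proof (rule inj_onI)
  fix \<alpha> \<beta> assume *: "\<alpha> \<in> {\<alpha>. composition \<alpha>}" "M \<alpha> = M \<beta>"
  then have "M \<beta> (Poly_Mapping.nth \<alpha>) = 1"
    using M_apply[of \<alpha> "Poly_Mapping.nth \<alpha>"] by (simp add: nonzero_parts_nth)
  then show "\<alpha> = \<beta>" using * by (simp add: M_apply nonzero_parts_nth split: if_splits)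
qed

lemma M_independent: "ser.independent (M ` {\<alpha>. composition \<alpha>})"
  unfolding ser.independent_explicit_module
proof (intro allI impI)
  fix t u v
  assume t: "finite t" "t \<subseteq> M ` {\<alpha>. composition \<alpha>}" "(\<Sum>v\<in>t. scale (u v) v) = 0" "v \<in> t"
  then obtain \<alpha> where \<alpha>: "composition \<alpha>" "v = M \<alpha>" by auto
  let ?w = "Poly_Mapping.nth \<alpha>"
  have "0 = (\<Sum>v'\<in>t. u v' * v' ?w)"
    using fun_cong[OF t(3), of ?w] by (simp add: sum_fun_apply scale_def)
  also have "\<dots> = (\<Sum>v'\<in>t. if v' = v then u v else 0)"
  proof (rule sum.cong)
    fix v' assume "v' \<in> t"
    then obtain \<alpha>' where "v' = M \<alpha>'" "composition \<alpha>'" using t by auto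
    then show "u v' * v' ?w = (if v' = v then u v else 0)"
      using \<alpha> inj_on_M by (auto simp: M_apply nonzero_parts_nth inj_on_def)
  qed simp
  finally show "u v = 0" using t by simp
qed

text \<open>The coefficients of a quasisymmetric function depend only on nonzero parts, and they are its
  coordinates in the monomial basis.\<close>

lemma M_coeff_apply:
  assumes "f \<in> QSym"
  shows "M_coeff f (nonzero_parts w) = f w"
proof -
  let ?B = "M ` {\<alpha>. composition \<alpha>}" and ?r = "ser.representation (M ` {\<alpha>. composition \<alpha>}) f"
  have fin: "finite {v. ?r v \<noteq> 0}" by (rule ser.finite_representation)
  have "f w = (\<Sum>v | ?r v \<noteq> 0. scale (?r v) v) w"
    using ser.sum_nonzero_representation_eq[OF M_independent] assms by (simp add: QSym_def)
  also have "\<dots> = (\<Sum>v | ?r v \<noteq> 0. if v = M (nonzero_parts w) then ?r v else 0)"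
    unfolding sum_fun_apply
  proof (rule sum.cong)
    fix v assume "v \<in> {v. ?r v \<noteq> 0}"
    then have "v \<in> ?B" using ser.representation_ne_zero by fast
    then obtain \<alpha> where "v = M \<alpha>" "composition \<alpha>" by blast
    then show "scale (?r v) v w = (if v = M (nonzero_parts w) then ?r v else 0)"
      using inj_on_M composition_nonzero_parts[of w]
      by (auto simp: M_apply scale_def inj_on_def)
  qed simp
  also have "\<dots> = ?r (M (nonzero_parts w))" using fin by (simp add: sum.delta')
  finally show ?thesis by (simp add: M_coeff_def)
qed

lemma finite_M_coeff: "finite {\<alpha>. composition \<alpha> \<and> M_coeff f \<alpha> \<noteq> 0}"
proof -
  have "finite (M ` {\<alpha>. composition \<alpha> \<and> M_coeff f \<alpha> \<noteq> 0})"
    by (rule finite_subset[OF _ ser.finite_representation[of "M ` {\<alpha>. composition \<alpha>}" f]])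
      (auto simp: M_coeff_def)
  then show ?thesis by (rule finite_imageD) (rule inj_on_subset[OF inj_on_M], blast)
qed

lemma finite_deconcatenations: "finite {(\<beta>, \<gamma>). \<beta> @ \<gamma> = \<alpha>}"
proof (rule finite_subset)
  show "{(\<beta>, \<gamma>). \<beta> @ \<gamma> = \<alpha>} \<subseteq> (\<lambda>k. (take k \<alpha>, drop k \<alpha>)) ` {..length \<alpha>}"
  proof clarify
    fix \<beta> \<gamma> :: "'a list"
    show "(\<beta>, \<gamma>) \<in> (\<lambda>k. (take k (\<beta> @ \<gamma>), drop k (\<beta> @ \<gamma>))) ` {..length (\<beta> @ \<gamma>)}"
      by (intro image_eqI[where x = "length \<beta>"]) auto
  qed
qed simp

lemma coproduct_apply_M_coeff:
  "coproduct f (u, v) = M_coeff f (nonzero_parts u @ nonzero_parts v)"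
proof -
  let ?A = "{\<alpha>. composition \<alpha> \<and> M_coeff f \<alpha> \<noteq> 0}"
  have "(\<Sum>(\<beta>, \<gamma>) \<in> {(\<beta>, \<gamma>). \<beta> @ \<gamma> = \<alpha>}. tensor (M \<beta>) (M \<gamma>)) (u, v) =
      (if nonzero_parts u @ nonzero_parts v = \<alpha> then 1 else 0)" for \<alpha>
  proof -
    have "(\<Sum>(\<beta>, \<gamma>) \<in> {(\<beta>, \<gamma>). \<beta> @ \<gamma> = \<alpha>}. tensor (M \<beta>) (M \<gamma>)) (u, v) =
        (\<Sum>p \<in> {(\<beta>, \<gamma>). \<beta> @ \<gamma> = \<alpha>}. if p = (nonzero_parts u, nonzero_parts v) then 1 else 0)"
      unfolding sum_fun_apply by (rule sum.cong) (auto simp: tensor_def M_apply split: if_splits)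
    also have "\<dots> = (if nonzero_parts u @ nonzero_parts v = \<alpha> then 1 else 0)"
      using finite_deconcatenations by (subst sum.delta) auto
    finally show ?thesis .
  qed
  then have "coproduct f (u, v) =
      (\<Sum>\<alpha>\<in>?A. if nonzero_parts u @ nonzero_parts v = \<alpha> then M_coeff f \<alpha> else 0)"
    unfolding coproduct_def sum_fun_apply scale_def by (intro sum.cong) auto
  also have "\<dots> = M_coeff f (nonzero_parts u @ nonzero_parts v)"
    using finite_M_coeff[of f] composition_nonzero_parts by (subst sum.delta') auto
  finally show ?thesis .
qed

text \<open>The coproduct of \<open>f\<close> substitutes the variables \<open>x\<^sub>1, x\<^sub>2, \<dots>, y\<^sub>1, y\<^sub>2, \<dots>\<close>: a coefficient of the
  coproduct is the coefficient of \<open>f\<close> at the exponents of \<open>x\<close> followed by those of \<open>y\<close>. Only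
  finitely many \<open>x\<close> occur in a given monomial, so the alphabet of \<open>y\<close> may start at position \<open>N\<close>.\<close>

lemma coproduct_apply_join:
  assumes "f \<in> QSym" "Poly_Mapping.keys u \<subseteq> {..<N}"
  shows "coproduct f (u, v) = f (join N u v)"
  using M_coeff_apply[OF assms(1), of "join N u v"]
  by (simp add: coproduct_apply_M_coeff nonzero_parts_join[OF assms(2)])

section \<open>Composition tableaux\<close>

lemma diagram_eq_Sigma: "diagram \<gamma> = Sigma {..<length \<gamma>} (\<lambda>i. {..<\<gamma> ! i})"
  by (auto simp: diagram_def)

lemma finite_diagram: "finite (diagram \<gamma>)"
  by (simp add: diagram_eq_Sigma)

lemma card_diagram: "card (diagram \<gamma>) = sum_list \<gamma>"
  by (simp add: diagram_eq_Sigma sum_list_sum_nth lessThan_atLeast0)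

lemma diagram_left: "(i, k') \<in> diagram \<gamma> \<Longrightarrow> k \<le> k' \<Longrightarrow> (i, k) \<in> diagram \<gamma>"
  by (auto simp: diagram_def)

lemma inner_cells_iff:
  assumes "length \<beta> \<le> length \<gamma>"
  shows "(r, k) \<in> inner_cells \<gamma> \<beta> \<longleftrightarrow>
    length \<gamma> - length \<beta> \<le> r \<and> (r - (length \<gamma> - length \<beta>), k) \<in> diagram \<beta>"
proof
  assume "length \<gamma> - length \<beta> \<le> r \<and> (r - (length \<gamma> - length \<beta>), k) \<in> diagram \<beta>"
  then show "(r, k) \<in> inner_cells \<gamma> \<beta>"
    unfolding inner_cells_def by (intro image_eqI[where x = "(r - (length \<gamma> - length \<beta>), k)"]) auto
qed (auto simp: inner_cells_def)

lemma inner_cells_left: "(i, k') \<in> inner_cells \<gamma> \<beta> \<Longrightarrow> k \<le> k' \<Longrightarrow> (i, k) \<in> inner_cells \<gamma> \<beta>"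
  unfolding inner_cells_def using diagram_left by fastforce

lemma inner_cells_subset:
  assumes "lower_left_contained \<beta> \<gamma>"
  shows "inner_cells \<gamma> \<beta> \<subseteq> diagram \<gamma>"
proof clarify
  fix r k assume *: "(r, k) \<in> inner_cells \<gamma> \<beta>"
  have len: "length \<beta> \<le> length \<gamma>" using assms by (simp add: lower_left_contained_def)
  define i where "i = r - (length \<gamma> - length \<beta>)"
  have i: "r = i + (length \<gamma> - length \<beta>)" "i < length \<beta>" "k < \<beta> ! i"
    using * len by (auto simp: inner_cells_iff i_def diagram_def)
  define i' where "i' = length \<beta> - Suc i"
  have "i' < length \<beta>" "i = length \<beta> - Suc i'" "r = length \<gamma> - Suc i'"
    using i len by (auto simp: i'_def)
  then have "\<beta> ! i \<le> \<gamma> ! r" using assms unfolding lower_left_contained_def by auto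
  then show "(r, k) \<in> diagram \<gamma>" using i len by (auto simp: diagram_def)
qed

lemma finite_skew_cells: "finite (skew_cells \<gamma> \<beta>)"
  by (simp add: skew_cells_def finite_diagram)

lemma card_skew_cells:
  assumes "lower_left_contained \<beta> \<gamma>"
  shows "card (skew_cells \<gamma> \<beta>) = sum_list \<gamma> - sum_list \<beta>"
proof -
  have "card (inner_cells \<gamma> \<beta>) = card (diagram \<beta>)"
    unfolding inner_cells_def by (rule card_image) (auto simp: inj_on_def)
  moreover have "finite (inner_cells \<gamma> \<beta>)" unfolding inner_cells_def by (simp add: finite_diagram)
  ultimately show ?thesis unfolding skew_cells_def
    by (simp add: card_Diff_subset inner_cells_subset[OF assms] card_diagram)
qed

text \<open>The definition with the attack relation unfolded and the two conditions on the support merged.\<close>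

lemma SSCT_iff:
  "T \<in> SSCT \<gamma> \<beta> \<longleftrightarrow> lower_left_contained \<beta> \<gamma> \<and>
     (\<forall>c. T c \<noteq> 0 \<longleftrightarrow> c \<in> skew_cells \<gamma> \<beta>) \<and>
     (\<forall>i k k'. (i, k) \<in> skew_cells \<gamma> \<beta> \<longrightarrow> (i, k') \<in> skew_cells \<gamma> \<beta> \<longrightarrow> k < k' \<longrightarrow>
        T (i, k') \<le> T (i, k)) \<and>
     (\<forall>i j. (i, 0) \<in> skew_cells \<gamma> \<beta> \<longrightarrow> (j, 0) \<in> skew_cells \<gamma> \<beta> \<longrightarrow> i < j \<longrightarrow> T (i, 0) < T (j, 0)) \<and>
     (\<forall>i j k. (i, k) \<in> diagram \<gamma> \<longrightarrow> i < j \<longrightarrow> (j, Suc k) \<in> skew_cells \<gamma> \<beta> \<longrightarrow>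
        (i, Suc k) \<notin> inner_cells \<gamma> \<beta> \<longrightarrow> (i, k) \<in> inner_cells \<gamma> \<beta> \<or> T (j, Suc k) \<le> T (i, k) \<longrightarrow>
        (i, Suc k) \<in> skew_cells \<gamma> \<beta> \<and> T (j, Suc k) < T (i, Suc k))"
proof -
  have "(\<forall>c \<in> skew_cells \<gamma> \<beta>. 0 < T c) \<and> (\<forall>c. c \<notin> skew_cells \<gamma> \<beta> \<longrightarrow> T c = 0) \<longleftrightarrow>
      (\<forall>c. T c \<noteq> 0 \<longleftrightarrow> c \<in> skew_cells \<gamma> \<beta>)"
    by (metis gr0I less_irrefl)
  moreover have "attacks \<gamma> \<beta> (i, k) (j, Suc k) \<longleftrightarrow>
      i < j \<and> (j, Suc k) \<in> skew_cells \<gamma> \<beta> \<and> (i, Suc k) \<notin> inner_cells \<gamma> \<beta>" for i j k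
    by (auto simp: attacks_def)
  ultimately show ?thesis unfolding SSCT_def by (simp only: mem_Collect_eq) blast
qed

lemma SSCT_contained: "T \<in> SSCT \<gamma> \<beta> \<Longrightarrow> lower_left_contained \<beta> \<gamma>"
  unfolding SSCT_iff by blast

lemma SSCT_nonzero_iff: "T \<in> SSCT \<gamma> \<beta> \<Longrightarrow> T c \<noteq> 0 \<longleftrightarrow> c \<in> skew_cells \<gamma> \<beta>"
  unfolding SSCT_iff by blast

lemma SSCT_row:
  assumes "T \<in> SSCT \<gamma> \<beta>" "(i, k) \<in> skew_cells \<gamma> \<beta>" "(i, k') \<in> skew_cells \<gamma> \<beta>" "k \<le> k'"
  shows "T (i, k') \<le> T (i, k)"
proof (cases "k = k'")
  case False
  then have "k < k'" using assms by simp
  then show ?thesis using assms unfolding SSCT_iff by blast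
qed simp

lemma SSCT_first_column:
  "T \<in> SSCT \<gamma> \<beta> \<Longrightarrow> (i, 0) \<in> skew_cells \<gamma> \<beta> \<Longrightarrow> (j, 0) \<in> skew_cells \<gamma> \<beta> \<Longrightarrow> i < j \<Longrightarrow>
    T (i, 0) < T (j, 0)"
  unfolding SSCT_iff by blast

lemma SSCT_attack:
  assumes "T \<in> SSCT \<gamma> \<beta>" "(i, k) \<in> diagram \<gamma>" "i < j" "(j, Suc k) \<in> skew_cells \<gamma> \<beta>"
    "(i, Suc k) \<notin> inner_cells \<gamma> \<beta>" "(i, k) \<in> inner_cells \<gamma> \<beta> \<or> T (j, Suc k) \<le> T (i, k)"
  shows "(i, Suc k) \<in> skew_cells \<gamma> \<beta> \<and> T (j, Suc k) < T (i, Suc k)"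
  using assms unfolding SSCT_iff by blast

text \<open>In the first column the entries increase strictly. Otherwise suppose \<open>T (i, m + 1) = T (j, m + 1)\<close> with
  \<open>i < j\<close>. The cell \<open>(i, m)\<close> attacks \<open>(j, m + 1)\<close>, and if it is not in \<open>\<beta>\<close> then its entry is at
  least \<open>T (i, m + 1)\<close> since rows decrease. So the attack condition gives
  \<open>T (j, m + 1) < T (i, m + 1)\<close>, a contradiction.\<close>

lemma SSCT_column_distinct_aux:
  assumes T: "T \<in> SSCT \<gamma> \<beta>" and c: "(i, k) \<in> skew_cells \<gamma> \<beta>" "(j, k) \<in> skew_cells \<gamma> \<beta>" and ij: "i < j"
  shows "T (i, k) \<noteq> T (j, k)"
proof (cases k)
  case 0
  then show ?thesis using SSCT_first_column[OF T] c ij by fastforce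
next
  case (Suc m)
  have d: "(i, m) \<in> diagram \<gamma>" "(i, Suc m) \<notin> inner_cells \<gamma> \<beta>"
    using c Suc diagram_left[of i k \<gamma> m] by (auto simp: skew_cells_def)
  show ?thesis
  proof
    assume eq: "T (i, k) = T (j, k)"
    have "(i, m) \<in> inner_cells \<gamma> \<beta> \<or> T (j, Suc m) \<le> T (i, m)"
      using SSCT_row[OF T, of i m "Suc m"] c d eq Suc by (auto simp: skew_cells_def)
    from SSCT_attack[OF T d(1) ij _ d(2) this] show False using c eq Suc by simp
  qed
qed

lemma SSCT_column_distinct:
  assumes "T \<in> SSCT \<gamma> \<beta>" "(i, k) \<in> skew_cells \<gamma> \<beta>" "(j, k) \<in> skew_cells \<gamma> \<beta>" "T (i, k) = T (j, k)"
  shows "i = j"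
  using assms SSCT_column_distinct_aux[of T \<gamma> \<beta> i k j] SSCT_column_distinct_aux[of T \<gamma> \<beta> j k i]
  by (metis nat_neq_iff)

lemma lookup_cont:
  assumes "finite {c. T c \<noteq> 0}"
  shows "Poly_Mapping.lookup (cont T) i = card {c. T c = Suc i}"
proof -
  have "{i. card {c. T c = Suc i} \<noteq> 0} \<subseteq> (\<lambda>c. T c - 1) ` {c. T c \<noteq> 0}"
  proof
    fix i assume "i \<in> {i. card {c. T c = Suc i} \<noteq> 0}"
    then obtain c where "T c = Suc i" by (auto simp: card_eq_0_iff)
    then show "i \<in> (\<lambda>c. T c - 1) ` {c. T c \<noteq> 0}" by (intro image_eqI[where x = c]) auto
  qed
  then have "finite {i. card {c. T c = Suc i} \<noteq> 0}" using assms by (meson finite_imageI finite_subset)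
  then show ?thesis by (simp add: cont_def Abs_poly_mapping_inverse)
qed

lemma SSCT_support: "T \<in> SSCT \<gamma> \<beta> \<Longrightarrow> {c. T c \<noteq> 0} = skew_cells \<gamma> \<beta>"
  using SSCT_nonzero_iff by blast

lemma SSCT_finite: "T \<in> SSCT \<gamma> \<beta> \<Longrightarrow> finite {c. T c \<noteq> 0}"
  unfolding SSCT_support by (rule finite_skew_cells)

lemma lookup_cont_SSCT:
  "T \<in> SSCT \<gamma> \<beta> \<Longrightarrow> Poly_Mapping.lookup (cont T) i = card {c. T c = Suc i}"
  by (rule lookup_cont) (rule SSCT_finite)

lemma weight_below_cont:
  assumes fin: "finite {c. T c \<noteq> 0}"
  shows "weight_below (cont T) i = card {c. T c \<noteq> 0 \<and> T c \<le> i}"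
proof (induction i)
  case 0
  have "{c. T c \<noteq> 0 \<and> T c \<le> 0} = {}" by auto
  then show ?case by (simp only: weight_below_0 card.empty)
next
  case (Suc i)
  have "{c. T c \<noteq> 0 \<and> T c \<le> Suc i} = {c. T c \<noteq> 0 \<and> T c \<le> i} \<union> {c. T c = Suc i}" by auto
  moreover have "card ({c. T c \<noteq> 0 \<and> T c \<le> i} \<union> {c. T c = Suc i}) =
      card {c. T c \<noteq> 0 \<and> T c \<le> i} + card {c. T c = Suc i}"
    by (rule card_Un_disjoint) (auto intro: finite_subset[OF _ fin])
  ultimately show ?case using Suc by (simp add: weight_below_Suc lookup_cont[OF fin])
qed

lemma sum_list_nonzero_parts_cont:
  assumes "T \<in> SSCT \<gamma> \<beta>"
  shows "sum_list (nonzero_parts (cont T)) = sum_list \<gamma> - sum_list \<beta>"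
proof -
  have fin: "finite {c. T c \<noteq> 0}" using assms by (rule SSCT_finite)
  obtain N where N: "Poly_Mapping.keys (cont T) \<subseteq> {..<N}" using ex_keys_bound by blast
  obtain N' where N': "\<forall>m\<in>T ` {c. T c \<noteq> 0}. m < N'"
    using fin finite_nat_set_iff_bounded by (metis finite_imageI)
  \<comment> \<open>Beyond both \<open>N\<close> and all entries of \<open>T\<close>, the cumulative weight is constant and counts all cells.\<close>
  have bound: "T c \<le> max N N'" if "T c \<noteq> 0" for c
    using bspec[OF N', of "T c"] that by simp
  have "weight_below (cont T) N = weight_below (cont T) (max N N')"
    using weight_below_beyond_keys[OF N, of "max N N'"] by simp
  also have "\<dots> = card {c. T c \<noteq> 0 \<and> T c \<le> max N N'}" by (rule weight_below_cont[OF fin])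
  also have "{c. T c \<noteq> 0 \<and> T c \<le> max N N'} = {c. T c \<noteq> 0}" using bound by blast
  also have "card \<dots> = sum_list \<gamma> - sum_list \<beta>"
    unfolding SSCT_support[OF assms] by (rule card_skew_cells[OF SSCT_contained[OF assms]])
  finally show ?thesis using sum_list_nonzero_parts[OF N] by simp
qed

section \<open>Standardization\<close>

text \<open>Only the order of the entries of \<open>U\<close> is prescribed, not their values, so that the same relation
  serves for standardizing \<open>T\<close> and for relabelling \<open>U\<close>.\<close>

definition is_standardization :: "(nat \<times> nat) set \<Rightarrow> (nat \<times> nat \<Rightarrow> nat) \<Rightarrow> (nat \<times> nat \<Rightarrow> nat) \<Rightarrow> bool" where
  "is_standardization X U T \<longleftrightarrow>
     (\<forall>c\<in>X. \<forall>d\<in>X. U c \<le> U d \<longleftrightarrow> T c < T d \<or> T c = T d \<and> snd d \<le> snd c)"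

lemma is_standardization_less:
  assumes "is_standardization X U T" "c \<in> X" "d \<in> X"
  shows "U c < U d \<longleftrightarrow> T c < T d \<or> T c = T d \<and> snd d < snd c"
  using assms unfolding is_standardization_def by (metis linorder_not_le nat_neq_iff order.asym)

lemma is_standardization_le:
  assumes "is_standardization X U T" "c \<in> X" "d \<in> X"
  shows "U c \<le> U d \<longleftrightarrow> T c < T d \<or> T c = T d \<and> snd d \<le> snd c"
  using assms unfolding is_standardization_def by blast

text \<open>The defining conditions compare two entries in the same row, in the same column, or in adjacent
  columns in the form \<open>T (j, k + 1) \<le> T (i, k)\<close>. Breaking ties from right to left preserves the
  first and the last of these weak comparisons in both directions. Two entries in the same column
  are compared strictly in the conclusions, and in the same column the tie-break adds no strict
  comparison.\<close>

lemma SSCT_standardization_iff: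
  assumes std: "is_standardization (skew_cells \<gamma> \<beta>) U T" and supp: "\<And>c. U c = 0 \<longleftrightarrow> T c = 0"
  shows "U \<in> SSCT \<gamma> \<beta> \<longleftrightarrow> T \<in> SSCT \<gamma> \<beta>"
proof
  note le = is_standardization_le[OF std] and less = is_standardization_less[OF std]
  {
    assume U: "U \<in> SSCT \<gamma> \<beta>"
    show "T \<in> SSCT \<gamma> \<beta>"
      unfolding SSCT_iff
    proof (intro conjI allI impI)
      fix i j k
      assume a: "(i, k) \<in> diagram \<gamma>" "i < j" "(j, Suc k) \<in> skew_cells \<gamma> \<beta>" "(i, Suc k) \<notin> inner_cells \<gamma> \<beta>"
        "(i, k) \<in> inner_cells \<gamma> \<beta> \<or> T (j, Suc k) \<le> T (i, k)"
      have "(i, k) \<in> inner_cells \<gamma> \<beta> \<or> U (j, Suc k) \<le> U (i, k)"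
      proof (cases "(i, k) \<in> inner_cells \<gamma> \<beta>")
        case False
        then have "(i, k) \<in> skew_cells \<gamma> \<beta>" using a by (simp add: skew_cells_def)
        then show ?thesis using le[of "(j, Suc k)" "(i, k)"] a False by auto
      qed simp
      from SSCT_attack[OF U a(1-4) this]
      show "(i, Suc k) \<in> skew_cells \<gamma> \<beta>" "T (j, Suc k) < T (i, Suc k)"
        using less[of "(j, Suc k)" "(i, Suc k)"] a by auto
    next
      fix i k k'
      assume "(i, k) \<in> skew_cells \<gamma> \<beta>" "(i, k') \<in> skew_cells \<gamma> \<beta>" "k < k'"
      then show "T (i, k') \<le> T (i, k)"
        using SSCT_row[OF U, of i k k'] le[of "(i, k')" "(i, k)"] by auto
    next
      fix i j
      assume "(i, 0) \<in> skew_cells \<gamma> \<beta>" "(j, 0) \<in> skew_cells \<gamma> \<beta>" "i < j"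
      then show "T (i, 0) < T (j, 0)"
        using SSCT_first_column[OF U, of i j] less[of "(i, 0)" "(j, 0)"] by auto
    next
      show "lower_left_contained \<beta> \<gamma>" by (rule SSCT_contained[OF U])
    next
      fix c
      show "T c \<noteq> 0 \<longleftrightarrow> c \<in> skew_cells \<gamma> \<beta>" using SSCT_nonzero_iff[OF U, of c] supp[of c] by simp
    qed
  }
  {
    assume T: "T \<in> SSCT \<gamma> \<beta>"
    show "U \<in> SSCT \<gamma> \<beta>"
      unfolding SSCT_iff
    proof (intro conjI allI impI)
      fix i j k
      assume a: "(i, k) \<in> diagram \<gamma>" "i < j" "(j, Suc k) \<in> skew_cells \<gamma> \<beta>" "(i, Suc k) \<notin> inner_cells \<gamma> \<beta>"
        "(i, k) \<in> inner_cells \<gamma> \<beta> \<or> U (j, Suc k) \<le> U (i, k)"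
      have "(i, k) \<in> inner_cells \<gamma> \<beta> \<or> T (j, Suc k) \<le> T (i, k)"
      proof (cases "(i, k) \<in> inner_cells \<gamma> \<beta>")
        case False
        then have "(i, k) \<in> skew_cells \<gamma> \<beta>" using a by (simp add: skew_cells_def)
        then show ?thesis using le[of "(j, Suc k)" "(i, k)"] a False by auto
      qed simp
      from SSCT_attack[OF T a(1-4) this]
      show "(i, Suc k) \<in> skew_cells \<gamma> \<beta>" "U (j, Suc k) < U (i, Suc k)"
        using less[of "(j, Suc k)" "(i, Suc k)"] a by auto
    next
      fix i k k'
      assume "(i, k) \<in> skew_cells \<gamma> \<beta>" "(i, k') \<in> skew_cells \<gamma> \<beta>" "k < k'"
      then show "U (i, k') \<le> U (i, k)"
        using SSCT_row[OF T, of i k k'] le[of "(i, k')" "(i, k)"] by auto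
    next
      fix i j
      assume "(i, 0) \<in> skew_cells \<gamma> \<beta>" "(j, 0) \<in> skew_cells \<gamma> \<beta>" "i < j"
      then show "U (i, 0) < U (j, 0)"
        using SSCT_first_column[OF T, of i j] less[of "(i, 0)" "(j, 0)"] by auto
    next
      show "lower_left_contained \<beta> \<gamma>" by (rule SSCT_contained[OF T])
    next
      fix c
      show "U c \<noteq> 0 \<longleftrightarrow> c \<in> skew_cells \<gamma> \<beta>" using SSCT_nonzero_iff[OF T, of c] supp[of c] by simp
    qed
  }
qed

lemma SCT_D:
  assumes "U \<in> SCT \<gamma> \<beta>"
  shows "U \<in> SSCT \<gamma> \<beta>" "bij_betw U (skew_cells \<gamma> \<beta>) {1..sum_list \<gamma> - sum_list \<beta>}"
    "num_cells U = sum_list \<gamma> - sum_list \<beta>"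
  using assms SSCT_support[of U \<gamma> \<beta>] card_skew_cells[of \<beta> \<gamma>] SSCT_contained[of U \<gamma> \<beta>]
  by (auto simp: SCT_def num_cells_def)

lemma bij_betw_card_Collect:
  assumes "bij_betw U X Y"
  shows "card {c \<in> X. P (U c)} = card {v \<in> Y. P v}"
proof (rule bij_betw_same_card)
  show "bij_betw U {c \<in> X. P (U c)} {v \<in> Y. P v}"
    using assms by (rule bij_betw_subset) (use assms in \<open>auto simp: bij_betw_def\<close>)
qed

text \<open>A standard filling is determined by the order of its entries.\<close>

lemma standard_eq_rank:
  assumes "bij_betw U X {1..n}" "c \<in> X"
  shows "U c = card {d \<in> X. U d \<le> U c}"
proof -
  have "U c \<in> {1..n}" using assms by (auto simp: bij_betw_def)
  then have "{v \<in> {1..n}. v \<le> U c} = {1..U c}" by auto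
  then show ?thesis using bij_betw_card_Collect[OF assms(1), of "\<lambda>v. v \<le> U c"] by simp
qed

text \<open>The \<open>v\<close>-th letter of the weakly increasing word of content \<open>w\<close>.\<close>

definition letter :: "(nat \<Rightarrow>\<^sub>0 nat) \<Rightarrow> nat \<Rightarrow> nat" where
  "letter w v = Suc (LEAST i. v \<le> weight_below w (Suc i))"

lemma letter_eq_iff:
  assumes "0 < v" "v \<le> weight_below w N"
  shows "letter w v = Suc i \<longleftrightarrow> weight_below w i < v \<and> v \<le> weight_below w (Suc i)"
proof
  let ?l = "LEAST i. v \<le> weight_below w (Suc i)"
  have "v \<le> weight_below w (Suc N)" using assms by (simp add: weight_below_Suc)
  then have l: "v \<le> weight_below w (Suc ?l)" by (rule LeastI)
  have "weight_below w ?l < v"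
  proof (cases ?l)
    case 0
    then show ?thesis using assms by simp
  next
    case (Suc m)
    then show ?thesis using not_less_Least[of m "\<lambda>i. v \<le> weight_below w (Suc i)"] by simp
  qed
  with l show "letter w v = Suc i \<Longrightarrow> weight_below w i < v \<and> v \<le> weight_below w (Suc i)"
    by (auto simp: letter_def)
  assume i: "weight_below w i < v \<and> v \<le> weight_below w (Suc i)"
  have "?l = i"
  proof (rule Least_equality)
    fix m assume "v \<le> weight_below w (Suc m)"
    then have "\<not> weight_below w (Suc m) \<le> weight_below w i" using i by simp
    then show "i \<le> m" using weight_below_mono[of "Suc m" i w] by (meson not_less_eq_eq)
  qed (use i in simp)
  then show "letter w v = Suc i" by (simp add: letter_def)
qed

lemma letter_mono:
  assumes "v \<le> v'" "v' \<le> weight_below w N"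
  shows "letter w v \<le> letter w v'"
proof -
  have "v' \<le> weight_below w (Suc N)" using assms by (simp add: weight_below_Suc)
  then have "v' \<le> weight_below w (Suc (LEAST i. v' \<le> weight_below w (Suc i)))" by (rule LeastI)
  then show ?thesis unfolding letter_def using assms(1) by (auto intro: Least_le)
qed

text \<open>Inverse of standardization: the entries \<open>1, \<dots>, n\<close> of \<open>U\<close> are replaced by the weakly
  increasing word of content \<open>w\<close>.\<close>

definition relabel :: "(nat \<Rightarrow>\<^sub>0 nat) \<Rightarrow> (nat \<times> nat \<Rightarrow> nat) \<Rightarrow> nat \<times> nat \<Rightarrow> nat" where
  "relabel w U c = (if U c = 0 then 0 else letter w (U c))"

lemma relabel_eq_0_iff: "relabel w U c = 0 \<longleftrightarrow> U c = 0"
  by (simp add: relabel_def letter_def)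

text \<open>The values \<open>v\<close> of \<open>U\<close> that become the same letter, except the last of them, are not partial
  sums of the nonzero parts of \<open>w\<close>. Hence none of them is a descent, and \<open>v + 1\<close> lies strictly to the
  left of \<open>v\<close>.\<close>

lemma columns_decrease_along_letter:
  assumes U: "U \<in> SCT \<gamma> \<beta>" and des: "descents U \<subseteq> partial_sums (nonzero_parts w)"
    and N: "sum_list \<gamma> - sum_list \<beta> \<le> weight_below w N"
    and c: "c \<in> skew_cells \<gamma> \<beta>" and d: "d \<in> skew_cells \<gamma> \<beta>"
    and cd: "U c < U d" and eq: "letter w (U c) = letter w (U d)"
  shows "snd d < snd c"
proof -
  let ?n = "sum_list \<gamma> - sum_list \<beta>"
  have img: "U ` skew_cells \<gamma> \<beta> = {1..?n}" using SCT_D(2)[OF U] by (simp add: bij_betw_def)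
  have rng: "0 < U e \<and> U e \<le> ?n" if "e \<in> skew_cells \<gamma> \<beta>" for e using that img by fastforce
  obtain i where i: "letter w (U c) = Suc i" by (simp add: letter_def)
  have "weight_below w i < U c"
    using letter_eq_iff[of "U c" w N i] rng[OF c] N i by auto
  moreover have "U d \<le> weight_below w (Suc i)"
    using letter_eq_iff[of "U d" w N i] rng[OF d] N i eq by auto
  \<comment> \<open>Cumulative weights increase, so none lies strictly between those of \<open>i\<close> and \<open>Suc i\<close>.\<close>
  ultimately have gap: "v \<notin> partial_sums (nonzero_parts w)" if "U c \<le> v" "v < U d" for v
  proof -
    have "weight_below w m \<noteq> v" for m
      using weight_below_mono[of m i w] weight_below_mono[of "Suc i" m w] that
        \<open>weight_below w i < U c\<close> \<open>U d \<le> weight_below w (Suc i)\<close>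
      by (cases "m \<le> i") auto
    then show ?thesis by (auto simp: partial_sums_nonzero_parts)
  qed
  have "\<forall>e. U e = v \<longrightarrow> snd e < snd c" if "Suc (U c) \<le> v" "v \<le> U d" for v
    using that
  proof (induction v rule: dec_induct)
    case base
    have "U c \<notin> descents U" using gap[of "U c"] des cd by blast
    moreover have "1 \<le> U c" "U c < num_cells U" using rng[OF c] rng[OF d] cd SCT_D(3)[OF U] by auto
    ultimately have "\<not> snd c \<le> snd e" if "U e = Suc (U c)" for e
      using that unfolding descents_def by (metis (mono_tags, lifting) mem_Collect_eq prod.collapse)
    then show ?case using linorder_not_le by blast
  next
    case (step v)
    have v: "1 \<le> v" "v < ?n" using step rng[OF d] by auto
    have "v \<in> {1..?n}" using v by simp
    then obtain e' where e': "U e' = v" using img by (metis imageE)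
    have "v \<notin> descents U" using gap[of v] des step by auto
    then have "\<not> snd e' \<le> snd e" if "U e = Suc v" for e
      using that e' v SCT_D(3)[OF U] unfolding descents_def
      by (metis (mono_tags, lifting) mem_Collect_eq prod.collapse)
    moreover have "snd e' < snd c"
    proof -
      have "v \<le> U d" using step by simp
      then have "\<forall>e. U e = v \<longrightarrow> snd e < snd c" by (rule step.IH)
      then show ?thesis using e' by blast
    qed
    ultimately show ?case by fastforce
  qed
  from this[of "U d"] have "\<forall>e. U e = U d \<longrightarrow> snd e < snd c" 
    using Suc_leI[OF cd] order_refl by blast
  then show ?thesis by blast
qed

lemma is_standardization_relabel:
  assumes U: "U \<in> SCT \<gamma> \<beta>" and des: "descents U \<subseteq> partial_sums (nonzero_parts w)"
    and N: "sum_list \<gamma> - sum_list \<beta> \<le> weight_below w N"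
  shows "is_standardization (skew_cells \<gamma> \<beta>) U (relabel w U)"
  unfolding is_standardization_def
proof (intro ballI)
  fix c d assume cd: "c \<in> skew_cells \<gamma> \<beta>" "d \<in> skew_cells \<gamma> \<beta>"
  have bij: "bij_betw U (skew_cells \<gamma> \<beta>) {1..sum_list \<gamma> - sum_list \<beta>}" by (rule SCT_D(2)[OF U])
  then have rng: "U c \<in> {1..sum_list \<gamma> - sum_list \<beta>}" "U d \<in> {1..sum_list \<gamma> - sum_list \<beta>}"
    using cd by (auto simp: bij_betw_def)
  have T: "relabel w U c = letter w (U c)" "relabel w U d = letter w (U d)"
    using rng by (auto simp: relabel_def)
  have mono: "U c \<le> U d \<Longrightarrow> letter w (U c) \<le> letter w (U d)"
    "U d \<le> U c \<Longrightarrow> letter w (U d) \<le> letter w (U c)"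
    using letter_mono[of _ _ w N] rng N by auto
  consider "U c < U d" | "c = d" | "U d < U c"
    using bij cd by (metis bij_betw_def inj_onD nat_neq_iff)
  then show "U c \<le> U d \<longleftrightarrow> relabel w U c < relabel w U d \<or>
      relabel w U c = relabel w U d \<and> snd d \<le> snd c"
  proof cases
    case 1
    then show ?thesis
      using columns_decrease_along_letter[OF U des N cd 1] mono T by (auto simp: order_less_le)
  next
    case 3
    then show ?thesis
      using columns_decrease_along_letter[OF U des N cd(2,1) 3] mono T by auto
  qed simp
qed

lemma cont_relabel:
  assumes U: "U \<in> SCT \<gamma> \<beta>" and w: "sum_list (nonzero_parts w) = sum_list \<gamma> - sum_list \<beta>"
  shows "cont (relabel w U) = w"
proof (rule poly_mapping_eqI)
  fix i
  let ?n = "sum_list \<gamma> - sum_list \<beta>"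
  obtain N where "Poly_Mapping.keys w \<subseteq> {..<N}" using ex_keys_bound by blast
  then have wN: "weight_below w m \<le> ?n" "weight_below w N = ?n" for m
    using weight_below_beyond_keys[of w N m] weight_below_mono[of m N w] sum_list_nonzero_parts[of w N] w
    by (cases "N \<le> m"; simp)+
  have supp: "{c. relabel w U c \<noteq> 0} = skew_cells \<gamma> \<beta>"
    using SSCT_support[OF SCT_D(1)[OF U]] by (simp add: relabel_eq_0_iff)
  have "Poly_Mapping.lookup (cont (relabel w U)) i = card {c. relabel w U c = Suc i}"
    by (rule lookup_cont) (simp only: supp finite_skew_cells)
  also have "{c. relabel w U c = Suc i} = {c \<in> skew_cells \<gamma> \<beta>. letter w (U c) = Suc i}"
    using SSCT_nonzero_iff[OF SCT_D(1)[OF U]] by (auto simp: relabel_def split: if_splits)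
  also have "card \<dots> = card {v \<in> {1..?n}. letter w v = Suc i}"
    by (rule bij_betw_card_Collect[OF SCT_D(2)[OF U]])
  also have "{v \<in> {1..?n}. letter w v = Suc i} = {weight_below w i <.. weight_below w (Suc i)}"
    using letter_eq_iff[of _ w N i] wN(2) wN(1)[of "Suc i"] by auto
  also have "card \<dots> = Poly_Mapping.lookup w i" by (simp add: weight_below_Suc)
  finally show "Poly_Mapping.lookup (cont (relabel w U)) i = Poly_Mapping.lookup w i" .
qed

definition standardize :: "(nat \<times> nat \<Rightarrow> nat) \<Rightarrow> nat \<times> nat \<Rightarrow> nat" where
  "standardize T c = (if T c = 0 then 0 else
     card {d. T d \<noteq> 0 \<and> (T d < T c \<or> T d = T c \<and> snd c \<le> snd d)})"

text \<open>The rank of a cell in the preorder given by the entry and, for ties, by the column from right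
  to left.\<close>

lemma is_standardization_standardize:
  assumes T: "T \<in> SSCT \<gamma> \<beta>"
  shows "is_standardization (skew_cells \<gamma> \<beta>) (standardize T) T"
  unfolding is_standardization_def
proof (intro ballI)
  fix c d assume cd: "c \<in> skew_cells \<gamma> \<beta>" "d \<in> skew_cells \<gamma> \<beta>"
  define le where "le = (\<lambda>c d. T c < T d \<or> T c = T d \<and> snd d \<le> snd c)"
  have fin: "finite {e. T e \<noteq> 0 \<and> le e c}" for c
    by (rule finite_subset[OF _ SSCT_finite[OF T]]) auto
  have nz: "T c \<noteq> 0" "T d \<noteq> 0" using cd T SSCT_nonzero_iff by blast+
  then have st: "standardize T c = card {e. T e \<noteq> 0 \<and> le e c}"
    "standardize T d = card {e. T e \<noteq> 0 \<and> le e d}" by (simp_all add: standardize_def le_def)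
  have "standardize T c \<le> standardize T d" if "le c d"
    unfolding st by (rule card_mono[OF fin]) (use that in \<open>auto simp: le_def\<close>)
  moreover have "standardize T d < standardize T c" if "\<not> le c d"
    unfolding st
  proof (rule psubset_card_mono[OF fin])
    have "c \<in> {e. T e \<noteq> 0 \<and> le e c}" "c \<notin> {e. T e \<noteq> 0 \<and> le e d}" using that nz by (auto simp: le_def)
    moreover have "{e. T e \<noteq> 0 \<and> le e d} \<subseteq> {e. T e \<noteq> 0 \<and> le e c}" using that by (auto simp: le_def)
    ultimately show "{e. T e \<noteq> 0 \<and> le e d} \<subset> {e. T e \<noteq> 0 \<and> le e c}" by blast
  qed
  ultimately show "standardize T c \<le> standardize T d \<longleftrightarrow> T c < T d \<or> T c = T d \<and> snd d \<le> snd c"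
    unfolding le_def by (meson linorder_not_le)
qed

lemma standardize_eq_0_iff:
  assumes T: "T \<in> SSCT \<gamma> \<beta>"
  shows "standardize T c = 0 \<longleftrightarrow> T c = 0"
proof -
  have "finite {d. T d \<noteq> 0 \<and> (T d < T c \<or> T d = T c \<and> snd c \<le> snd d)}"
    by (rule finite_subset[OF _ SSCT_finite[OF T]]) auto
  moreover have "c \<in> {d. T d \<noteq> 0 \<and> (T d < T c \<or> T d = T c \<and> snd c \<le> snd d)}" if "T c \<noteq> 0"
    using that by blast
  ultimately show ?thesis unfolding standardize_def by (metis (no_types, lifting) card_0_eq empty_iff)
qed

text \<open>Cells of equal rank have the same entry and lie in the same column, so they coincide; hence the
  ranks are \<open>1, \<dots>, n\<close>.\<close>

lemma standardize_in_SCT: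
  assumes T: "T \<in> SSCT \<gamma> \<beta>"
  shows "standardize T \<in> SCT \<gamma> \<beta>"
proof -
  let ?X = "skew_cells \<gamma> \<beta>" and ?U = "standardize T"
  note std = is_standardization_standardize[OF T]
  have U: "?U \<in> SSCT \<gamma> \<beta>"
    using SSCT_standardization_iff[OF std] standardize_eq_0_iff[OF T] T by blast
  have card: "card ?X = sum_list \<gamma> - sum_list \<beta>" by (rule card_skew_cells[OF SSCT_contained[OF T]])
  have "inj_on ?U ?X"
  proof (rule inj_onI)
    fix c d assume *: "c \<in> ?X" "d \<in> ?X" "?U c = ?U d"
    then have "T c = T d" "snd c = snd d"
      using is_standardization_le[OF std, of c d] is_standardization_le[OF std, of d c] by auto
    then show "c = d" using SSCT_column_distinct[OF T, of "fst c" "snd c" "fst d"] *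
      by (metis prod.collapse)
  qed
  moreover have "?U ` ?X \<subseteq> {1..card ?X}"
  proof clarify
    fix r k assume *: "(r, k) \<in> ?X"
    then have "?U (r, k) \<noteq> 0" using SSCT_nonzero_iff[OF U] by blast
    moreover have nz: "T (r, k) \<noteq> 0" using SSCT_nonzero_iff[OF T] * by blast
    have "?U (r, k) \<le> card ?X"
      unfolding standardize_def if_not_P[OF nz] SSCT_support[OF T, symmetric]
      by (rule card_mono[OF SSCT_finite[OF T]]) blast
    ultimately show "?U (r, k) \<in> {1..card ?X}" by simp
  qed
  ultimately have "?U ` ?X = {1..card ?X}"
    by (intro card_subset_eq) (simp_all add: card_image)
  then show ?thesis using U \<open>inj_on ?U ?X\<close> by (simp add: SCT_def bij_betw_def card)
qed

lemma relabel_standardize: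
  assumes T: "T \<in> SSCT \<gamma> \<beta>"
  shows "relabel (cont T) (standardize T) = T"
proof
  fix c
  let ?U = "standardize T"
  have fin: "finite {c. T c \<noteq> 0}" by (rule SSCT_finite[OF T])
  show "relabel (cont T) ?U c = T c"
  proof (cases "T c = 0")
    case True
    then show ?thesis by (simp add: relabel_def standardize_def)
  next
    case False
    then obtain i where i: "T c = Suc i" by (cases "T c") auto
    let ?D = "{d. T d \<noteq> 0 \<and> (T d < T c \<or> T d = T c \<and> snd c \<le> snd d)}"
    have U: "?U c = card ?D" using False by (simp add: standardize_def)
    have finD: "finite ?D" by (rule finite_subset[OF _ fin]) auto
    have "weight_below (cont T) i < ?U c"
      unfolding weight_below_cont[OF fin] U
    proof (rule psubset_card_mono[OF finD])
      have "c \<in> ?D" "c \<notin> {c. T c \<noteq> 0 \<and> T c \<le> i}" using i by auto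
      moreover have "{c. T c \<noteq> 0 \<and> T c \<le> i} \<subseteq> ?D" using i by auto
      ultimately show "{c. T c \<noteq> 0 \<and> T c \<le> i} \<subset> ?D" by blast
    qed
    moreover have "?U c \<le> weight_below (cont T) (Suc i)"
      unfolding weight_below_cont[OF fin] U
      by (rule card_mono) (use i in \<open>auto intro: finite_subset[OF _ fin]\<close>)
    ultimately have "letter (cont T) (?U c) = Suc i"
      using letter_eq_iff[of "?U c" "cont T" "Suc i" i] by simp
    then show ?thesis using standardize_eq_0_iff[OF T, of c] i by (simp add: relabel_def)
  qed
qed

text \<open>If \<open>i\<close> is a descent of the standardization, then \<open>i\<close> and \<open>i + 1\<close> come from different entries of
  \<open>T\<close>, as equal entries are numbered from right to left. So \<open>i\<close> counts all entries of \<open>T\<close> up to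
  the one at \<open>i\<close>, and this number is a partial sum of the content.\<close>

lemma descents_standardize:
  assumes T: "T \<in> SSCT \<gamma> \<beta>"
  shows "descents (standardize T) \<subseteq> partial_sums (nonzero_parts (cont T))"
proof
  let ?U = "standardize T" and ?X = "skew_cells \<gamma> \<beta>"
  note std = is_standardization_standardize[OF T]
  have fin: "finite {c. T c \<noteq> 0}" by (rule SSCT_finite[OF T])
  fix i assume "i \<in> descents ?U"
  then obtain c d where i: "1 \<le> i" "?U c = i" "?U d = Suc i" "snd c \<le> snd d"
    unfolding descents_def by fastforce
  have cd: "c \<in> ?X" "d \<in> ?X"
    using i standardize_eq_0_iff[OF T] SSCT_nonzero_iff[OF T]
    by (metis One_nat_def not_one_le_zero, metis nat.distinct(1))
  then have lt: "T c < T d" using is_standardization_less[OF std, of c d] i by auto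
  have "?U e \<le> ?U c \<longleftrightarrow> T e \<le> T c" if e: "e \<in> ?X" for e
  proof
    assume "?U e \<le> ?U c"
    then show "T e \<le> T c" using is_standardization_le[OF std e cd(1)] by auto
  next
    assume "T e \<le> T c"
    then have "?U e < ?U d" using is_standardization_less[OF std e cd(2)] lt by auto
    then show "?U e \<le> ?U c" using i by simp
  qed
  then have "{e \<in> ?X. ?U e \<le> ?U c} = {e. T e \<noteq> 0 \<and> T e \<le> T c}"
    using SSCT_nonzero_iff[OF T] by blast
  moreover have "?U c = card {e \<in> ?X. ?U e \<le> ?U c}"
    using standard_eq_rank[OF SCT_D(2)[OF standardize_in_SCT[OF T]] cd(1)] .
  ultimately have "i = weight_below (cont T) (T c)" using i by (simp add: weight_below_cont[OF fin])
  then show "i \<in> partial_sums (nonzero_parts (cont T))" using i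
    by (auto simp: partial_sums_nonzero_parts)
qed

text \<open>Standardization and relabelling are inverse to each other. Relabelling is injective because the
  relabelled tableau determines the order of the entries of \<open>U\<close>, hence \<open>U\<close>.\<close>

lemma bij_betw_relabel:
  assumes w: "sum_list (nonzero_parts w) = sum_list \<gamma> - sum_list \<beta>"
  shows "bij_betw (relabel w) {U \<in> SCT \<gamma> \<beta>. descents U \<subseteq> partial_sums (nonzero_parts w)}
    {T \<in> SSCT \<gamma> \<beta>. cont T = w}" (is "bij_betw _ ?A ?B")
proof -
  obtain N where "Poly_Mapping.keys w \<subseteq> {..<N}" using ex_keys_bound by blast
  then have N: "sum_list \<gamma> - sum_list \<beta> \<le> weight_below w N"
    using sum_list_nonzero_parts[of w N] w by simp
  have std: "is_standardization (skew_cells \<gamma> \<beta>) U (relabel w U)" if "U \<in> ?A" for U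
    using that N is_standardization_relabel by blast
  have "inj_on (relabel w) ?A"
  proof (rule inj_onI)
    fix U V assume UV: "U \<in> ?A" "V \<in> ?A" "relabel w U = relabel w V"
    show "U = V"
    proof
      fix c
      show "U c = V c"
      proof (cases "c \<in> skew_cells \<gamma> \<beta>")
        case True
        have "U d \<le> U c \<longleftrightarrow> V d \<le> V c" if "d \<in> skew_cells \<gamma> \<beta>" for d
          using is_standardization_le[OF std[OF UV(1)] that True]
            is_standardization_le[OF std[OF UV(2)] that True] UV(3) by simp
        then have "{d \<in> skew_cells \<gamma> \<beta>. U d \<le> U c} = {d \<in> skew_cells \<gamma> \<beta>. V d \<le> V c}" by blast
        moreover have "U \<in> SCT \<gamma> \<beta>" "V \<in> SCT \<gamma> \<beta>" using UV by blast+
        ultimately show ?thesis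
          using standard_eq_rank[OF SCT_D(2) True, of U] standard_eq_rank[OF SCT_D(2) True, of V]
          by simp
      next
        case False
        have "U \<in> SSCT \<gamma> \<beta>" "V \<in> SSCT \<gamma> \<beta>" using UV SCT_D(1) by blast+
        then have "U c = 0" "V c = 0" using SSCT_nonzero_iff False by blast+
        then show ?thesis by simp
      qed
    qed
  qed
  moreover have "relabel w U \<in> ?B" if "U \<in> ?A" for U
    using that cont_relabel[OF _ w] SSCT_standardization_iff[OF std[OF that]] SCT_D(1)[of U]
    by (auto simp: relabel_eq_0_iff)
  moreover have "T \<in> relabel w ` ?A" if "T \<in> ?B" for T
  proof (rule image_eqI[where x = "standardize T"])
    have T: "T \<in> SSCT \<gamma> \<beta>" "cont T = w" using that by auto
    show "T = relabel w (standardize T)" using relabel_standardize[OF T(1)] T(2) by simp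
    show "standardize T \<in> ?A"
      using standardize_in_SCT[OF T(1)] descents_standardize[OF T(1)] T(2) by blast
  qed
  ultimately show ?thesis unfolding bij_betw_def by blast
qed

lemma finite_SCT: "finite (SCT \<gamma> \<beta>)"
proof (rule finite_subset)
  show "SCT \<gamma> \<beta> \<subseteq> {U. \<forall>c. (c \<in> skew_cells \<gamma> \<beta> \<longrightarrow> U c \<in> {1..sum_list \<gamma> - sum_list \<beta>}) \<and>
      (c \<notin> skew_cells \<gamma> \<beta> \<longrightarrow> U c = 0)}"
    using SCT_D SSCT_nonzero_iff by (fastforce simp: bij_betw_def)
qed (intro finite_set_of_finite_funs finite_skew_cells, simp)

lemma SSCT_series_eq_sum_L:
  "formal_sum (\<lambda>T. monom (cont T)) (SSCT \<gamma> \<beta>) = (\<Sum>U \<in> SCT \<gamma> \<beta>. L (Des U))"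
proof
  fix w
  let ?n = "sum_list \<gamma> - sum_list \<beta>" and ?\<alpha> = "nonzero_parts w"
  have "(\<Sum>U \<in> SCT \<gamma> \<beta>. L (Des U)) w =
      (\<Sum>U \<in> SCT \<gamma> \<beta>. if sum_list ?\<alpha> = ?n \<and> descents U \<subseteq> partial_sums ?\<alpha> then 1 else 0)"
    unfolding sum_fun_apply L_apply refines_Des_iff[OF composition_nonzero_parts]
    by (intro sum.cong refl) (simp add: SCT_D(3))
  also have "\<dots> = of_nat (card {U \<in> SCT \<gamma> \<beta>. sum_list ?\<alpha> = ?n \<and> descents U \<subseteq> partial_sums ?\<alpha>})"
    using finite_SCT by (simp add: sum.inter_filter[symmetric])
  also have "card {U \<in> SCT \<gamma> \<beta>. sum_list ?\<alpha> = ?n \<and> descents U \<subseteq> partial_sums ?\<alpha>} =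
      card {T \<in> SSCT \<gamma> \<beta>. cont T = w}"
  proof (cases "sum_list ?\<alpha> = ?n")
    case True
    then show ?thesis using bij_betw_same_card[OF bij_betw_relabel[OF True]] by simp
  next
    case False
    then have "{T \<in> SSCT \<gamma> \<beta>. cont T = w} = {}" using sum_list_nonzero_parts_cont by blast
    moreover from False have "{U \<in> SCT \<gamma> \<beta>. sum_list ?\<alpha> = ?n \<and> descents U \<subseteq> partial_sums ?\<alpha>} = {}"
      by blast
    ultimately show ?thesis by (simp only:)
  qed
  finally show "formal_sum (\<lambda>T. monom (cont T)) (SSCT \<gamma> \<beta>) w = (\<Sum>U \<in> SCT \<gamma> \<beta>. L (Des U)) w"
    by (simp add: formal_sum_monom_apply)
qed

text \<open>Quasisymmetry comes for free from the expansion in fundamental functions.\<close>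

lemma SSCT_series_in_QSym: "formal_sum (\<lambda>T. monom (cont T)) (SSCT \<gamma> \<beta>) \<in> QSym"
  unfolding SSCT_series_eq_sum_L using L_in_QSym by (auto simp: QSym_def intro: ser.span_sum)

section \<open>Linear independence of the quasisymmetric Schur functions\<close>

lemma inner_cells_Nil [simp]: "inner_cells \<gamma> [] = {}"
  by (simp add: inner_cells_def diagram_def)

lemma skew_cells_Nil [simp]: "skew_cells \<gamma> [] = diagram \<gamma>"
  by (simp add: skew_cells_def)

lemma SSCT_straight_iff:
  "T \<in> SSCT \<gamma> [] \<longleftrightarrow> (\<forall>c. T c \<noteq> 0 \<longleftrightarrow> c \<in> diagram \<gamma>) \<and>
     (\<forall>i k k'. (i, k) \<in> diagram \<gamma> \<longrightarrow> (i, k') \<in> diagram \<gamma> \<longrightarrow> k < k' \<longrightarrow> T (i, k') \<le> T (i, k)) \<and>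
     (\<forall>i j. (i, 0) \<in> diagram \<gamma> \<longrightarrow> (j, 0) \<in> diagram \<gamma> \<longrightarrow> i < j \<longrightarrow> T (i, 0) < T (j, 0)) \<and>
     (\<forall>i j k. (i, k) \<in> diagram \<gamma> \<longrightarrow> i < j \<longrightarrow> (j, Suc k) \<in> diagram \<gamma> \<longrightarrow> T (j, Suc k) \<le> T (i, k) \<longrightarrow>
        (i, Suc k) \<in> diagram \<gamma> \<and> T (j, Suc k) < T (i, Suc k))"
  unfolding SSCT_iff skew_cells_Nil inner_cells_Nil
  by (simp only: lower_left_contained_def empty_iff not_False_eq_True simp_thms list.size
      le0 not_less_zero)

lemma SSCT_straight_attack:
  assumes "T \<in> SSCT \<gamma> []" "(i, k) \<in> diagram \<gamma>" "i < j" "(j, Suc k) \<in> diagram \<gamma>"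
    "T (j, Suc k) \<le> T (i, k)"
  shows "(i, Suc k) \<in> diagram \<gamma> \<and> T (j, Suc k) < T (i, Suc k)"
  using assms unfolding SSCT_straight_iff by blast

lemma SSCT_restrict_rows:
  assumes "T \<in> SSCT (\<delta> @ [d]) []"
  shows "(\<lambda>c. if fst c < length \<delta> then T c else 0) \<in> SSCT \<delta> []"
proof -
  have D: "(i, k) \<in> diagram \<delta> \<longleftrightarrow> (i, k) \<in> diagram (\<delta> @ [d]) \<and> i < length \<delta>" for i k
    by (auto simp: diagram_def nth_append)
  note nz = SSCT_nonzero_iff[OF assms, unfolded skew_cells_Nil]
    and row = SSCT_row[OF assms, unfolded skew_cells_Nil]
    and col = SSCT_first_column[OF assms, unfolded skew_cells_Nil]
  show ?thesis
    unfolding SSCT_straight_iff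
  proof (intro conjI allI impI)
    fix c :: "nat \<times> nat"
    show "(if fst c < length \<delta> then T c else 0) \<noteq> 0 \<longleftrightarrow> c \<in> diagram \<delta>"
      using nz[of c] D[of "fst c" "snd c"] by simp
  next
    fix i j k
    assume a: "(i, k) \<in> diagram \<delta>" "i < j" "(j, Suc k) \<in> diagram \<delta>"
      "(if fst (j, Suc k) < length \<delta> then T (j, Suc k) else 0)
        \<le> (if fst (i, k) < length \<delta> then T (i, k) else 0)"
    then have "T (j, Suc k) \<le> T (i, k)" using D by simp
    then have "(i, Suc k) \<in> diagram (\<delta> @ [d]) \<and> T (j, Suc k) < T (i, Suc k)"
      using a D by (intro SSCT_straight_attack[OF assms]) auto
    then show "(i, Suc k) \<in> diagram \<delta>" "(if fst (j, Suc k) < length \<delta> then T (j, Suc k) else 0)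
        < (if fst (i, Suc k) < length \<delta> then T (i, Suc k) else 0)"
      using a D by auto
  qed (use D row col in auto)
qed

text \<open>Lists are compared lexicographically. All cells with the largest letter lie in the last
  row: their rows start with that letter, and the first column is strictly increasing. So the last part
  of \<open>\<alpha>\<close> is at most that of \<open>\<delta>\<close>; in case of equality the last row is constant, and deleting it
  reduces the claim to shorter compositions.\<close>

lemma SSCT_content_lex_le:
  assumes "T \<in> SSCT \<delta> []" "composition \<delta>" "composition \<alpha>"
    "\<And>i. card {c. T c = Suc i} = nth_default 0 \<alpha> i"
  shows "rev \<alpha> \<le> rev \<delta>"
  using assms
proof (induction \<alpha> arbitrary: \<delta> T rule: rev_induct)
  case (snoc a \<alpha>)
  note T = snoc.prems(1) and cont = snoc.prems(4)
  note nz = SSCT_nonzero_iff[OF T, unfolded skew_cells_Nil]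
    and row = SSCT_row[OF T, unfolded skew_cells_Nil]
    and col = SSCT_first_column[OF T, unfolded skew_cells_Nil]
  let ?m = "Suc (length \<alpha>)"
  have fin: "finite {c. T c = x}" if "x \<noteq> 0" for x
    by (rule finite_subset[OF _ SSCT_finite[OF T]]) (use that in auto)
  have le_m: "T c \<le> ?m" for c
  proof (rule ccontr)
    assume "\<not> T c \<le> ?m"
    then obtain x where x: "T c = Suc x" "length \<alpha> < x" by (cases "T c") auto
    then have "card {c. T c = Suc x} = 0" using cont[of x] by (simp add: nth_default_def)
    then have "{c. T c = Suc x} = {}" using fin[of "Suc x"] by (simp only: card_eq_0_iff) blast
    then show False using x(1) by blast
  qed
  have card_m: "card {c. T c = ?m} = a" using cont[of "length \<alpha>"] by (simp add: nth_default_def)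
  have "0 < a" using snoc.prems(3) by simp
  then obtain c0 where "T c0 = ?m" using card_m by (metis (mono_tags, lifting) Collect_empty_eq card.empty less_irrefl)
  then have "c0 \<in> diagram \<delta>" using nz[of c0] by simp
  then have "\<delta> \<noteq> []" by (auto simp: diagram_def)
  then obtain \<delta>' d where \<delta>: "\<delta> = \<delta>' @ [d]" by (metis rev_exhaust)
  have "0 < d" "composition \<delta>'" using snoc.prems(2) \<delta> by auto
  have last: "(length \<delta>', k) \<in> diagram \<delta> \<longleftrightarrow> k < d" for k by (simp add: diagram_def \<delta>)
  have sub: "{c. T c = ?m} \<subseteq> {length \<delta>'} \<times> {..<d}"
  proof clarify
    fix r k assume rk: "T (r, k) = ?m"
    then have D: "(r, k) \<in> diagram \<delta>" using nz[of "(r, k)"] by simp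
    then have D0: "(r, 0) \<in> diagram \<delta>" using diagram_left by blast
    have "T (r, 0) = ?m" using row[OF D0 D] rk le_m[of "(r, 0)"] by simp
    have "\<not> r < length \<delta>'"
    proof
      assume "r < length \<delta>'"
      then have "T (r, 0) < T (length \<delta>', 0)" using col[OF D0] last \<open>0 < d\<close> by blast
      then show False using \<open>T (r, 0) = ?m\<close> le_m[of "(length \<delta>', 0)"] by simp
    qed
    moreover have "r < Suc (length \<delta>')" using D by (simp add: diagram_def \<delta>)
    ultimately have "r = length \<delta>'" by simp
    then show "r \<in> {length \<delta>'} \<and> k \<in> {..<d}" using D last by simp
  qed
  have "card ({length \<delta>'} \<times> {..<d}) = d" by simp
  then have "a \<le> d" using card_mono[OF _ sub] card_m by simp
  show ?case
  proof (cases "a = d")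
    case False
    then show ?thesis using \<open>a \<le> d\<close> \<delta> by simp
  next
    case True
    have eq: "{c. T c = ?m} = {length \<delta>'} \<times> {..<d}"
      by (rule card_subset_eq[OF _ sub]) (simp_all add: card_m True)
    let ?T = "\<lambda>c. if fst c < length \<delta>' then T c else 0"
    have "?T \<in> SSCT \<delta>' []" using T \<delta> SSCT_restrict_rows by simp
    moreover have "card {c. ?T c = Suc i} = nth_default 0 \<alpha> i" for i
    proof (cases "i = length \<alpha>")
      case True
      have "?T c \<noteq> Suc i" for c
      proof
        assume c: "?T c = Suc i"
        then have "fst c < length \<delta>'" by (meson nat.distinct(1))
        with c have "c \<in> {length \<delta>'} \<times> {..<d}" using eq True by auto
        with \<open>fst c < length \<delta>'\<close> show False by auto
      qed
      then have "{c. ?T c = Suc i} = {}" by blast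
      then show ?thesis using True by (simp only: card.empty nth_default_def less_irrefl if_False)
    next
      case False
      have "fst c < length \<delta>'" if c: "T c = Suc i" for c
      proof -
        have D: "c \<in> diagram \<delta>" using c nz[of c] by simp
        have "fst c \<noteq> length \<delta>'"
        proof
          assume "fst c = length \<delta>'"
          then have "c \<in> {length \<delta>'} \<times> {..<d}" using D last[of "snd c"] by (cases c) simp
          then have "T c = ?m" using eq by blast
          then show False using c False by simp
        qed
        moreover have "fst c < Suc (length \<delta>')" using D by (cases c) (simp add: diagram_def \<delta>)
        ultimately show ?thesis by simp
      qed
      then have "{c. ?T c = Suc i} = {c. T c = Suc i}" by auto
      then show ?thesis using cont[of i] False by (simp add: nth_default_def nth_append)
    qed
    ultimately have "rev \<alpha> \<le> rev \<delta>'"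
      using snoc.IH[of ?T \<delta>'] \<open>composition \<delta>'\<close> snoc.prems(3) by simp
    then show ?thesis using True \<delta> by simp
  qed
qed simp

text \<open>In the tableau with constant rows, filled by \<open>1, 2, \<dots>\<close> from the top, every row is smaller than
  those below it, so the attack condition is void.\<close>

lemma ex_SSCT_own_content: "\<exists>T \<in> SSCT \<alpha> []. cont T = Poly_Mapping.nth \<alpha>"
proof
  let ?T = "\<lambda>c. if c \<in> diagram \<alpha> then Suc (fst c) else 0"
  show T: "?T \<in> SSCT \<alpha> []"
    unfolding SSCT_straight_iff by (auto simp: diagram_def)
  show "cont ?T = Poly_Mapping.nth \<alpha>"
  proof (rule poly_mapping_eqI)
    fix i
    have "{c. ?T c = Suc i} = {i} \<times> {..<nth_default 0 \<alpha> i}"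
      by (auto simp: diagram_def nth_default_def split: if_splits)
    then have "card {c. ?T c = Suc i} = nth_default 0 \<alpha> i"
      by (simp only: card_cartesian_product card_lessThan) simp
    then show "Poly_Mapping.lookup (cont ?T) i = Poly_Mapping.lookup (Poly_Mapping.nth \<alpha>) i"
      using lookup_cont_SSCT[OF T, of i] by (simp only: lookup_nth)
  qed
qed

lemma finite_SSCT_cont: "finite {T \<in> SSCT \<gamma> \<beta>. cont T = w}"
proof (cases "sum_list (nonzero_parts w) = sum_list \<gamma> - sum_list \<beta>")
  case True
  show ?thesis using bij_betw_finite[OF bij_betw_relabel[OF True]] finite_SCT by simp
next
  case False
  then have "{T \<in> SSCT \<gamma> \<beta>. cont T = w} = {}" using sum_list_nonzero_parts_cont by blast
  then show ?thesis by (simp only: finite.emptyI)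
qed

lemma QS_apply: "QS \<alpha> w = of_nat (card {T \<in> SSCT \<alpha> []. cont T = w})"
  by (simp add: QS_def formal_sum_monom_apply)

lemma QS_own_content: "QS \<alpha> (Poly_Mapping.nth \<alpha>) \<noteq> 0"
  using ex_SSCT_own_content[of \<alpha>] finite_SSCT_cont[of \<alpha> "[]" "Poly_Mapping.nth \<alpha>"]
  by (auto simp: QS_apply)

lemma QS_triangular:
  assumes "composition \<delta>" "composition \<alpha>" "QS \<delta> (Poly_Mapping.nth \<alpha>) \<noteq> 0"
  shows "rev \<alpha> \<le> rev \<delta>"
proof -
  have "{T \<in> SSCT \<delta> []. cont T = Poly_Mapping.nth \<alpha>} \<noteq> {}"
    using assms(3) unfolding QS_apply by (metis card.empty of_nat_0)
  then obtain T where T: "T \<in> SSCT \<delta> []" "cont T = Poly_Mapping.nth \<alpha>" by blast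
  have "card {c. T c = Suc i} = nth_default 0 \<alpha> i" for i
    using lookup_cont_SSCT[OF T(1), of i] by (simp only: T(2) lookup_nth)
  then show ?thesis using SSCT_content_lex_le[OF T(1) assms(1,2)] by blast
qed

text \<open>Among the compositions with nonzero coefficient take the one, \<open>\<alpha>\<close>, whose reversal is
  lexicographically largest. By triangularity only \<open>QS \<alpha>\<close> contributes to the coefficient at the
  exponent \<open>\<alpha>\<close>.\<close>

lemma QS_independent:
  assumes "finite B" "\<And>\<beta>. \<beta> \<in> B \<Longrightarrow> composition \<beta>" "\<And>v. (\<Sum>\<beta>\<in>B. a \<beta> * QS \<beta> v) = 0" "\<beta> \<in> B"
  shows "a \<beta> = 0"
proof (rule ccontr)
  assume "a \<beta> \<noteq> 0"
  define B' where "B' = {\<beta> \<in> B. a \<beta> \<noteq> 0}"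
  have B': "finite (rev ` B')" "rev ` B' \<noteq> {}" using assms \<open>a \<beta> \<noteq> 0\<close> by (auto simp: B'_def)
  then have "Max (rev ` B') \<in> rev ` B'" by (rule Max_in)
  then obtain \<alpha> where \<alpha>: "\<alpha> \<in> B'" "Max (rev ` B') = rev \<alpha>" by blast
  have top: "rev \<delta> \<le> rev \<alpha>" if "\<delta> \<in> B'" for \<delta>
    using Max_ge[OF B'(1), of "rev \<delta>"] that \<alpha>(2) by simp
  let ?w = "Poly_Mapping.nth \<alpha>"
  have "0 = (\<Sum>\<delta>\<in>B. a \<delta> * QS \<delta> ?w)" using assms(3) by simp
  also have "\<dots> = (\<Sum>\<delta>\<in>B. if \<delta> = \<alpha> then a \<alpha> * QS \<alpha> ?w else 0)"
  proof (rule sum.cong)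
    fix \<delta> assume \<delta>: "\<delta> \<in> B"
    show "a \<delta> * QS \<delta> ?w = (if \<delta> = \<alpha> then a \<alpha> * QS \<alpha> ?w else 0)"
    proof (cases "\<delta> = \<alpha> \<or> a \<delta> = 0 \<or> QS \<delta> ?w = 0")
      case False
      then have "rev \<delta> \<le> rev \<alpha>" using top \<delta> by (simp add: B'_def)
      moreover have "rev \<alpha> \<le> rev \<delta>"
        using QS_triangular[of \<delta> \<alpha>] False \<delta> \<alpha>(1) assms(2) by (simp add: B'_def)
      ultimately have "rev \<delta> = rev \<alpha>" by (rule antisym)
      then show ?thesis using False by simp
    qed auto
  qed simp
  also have "\<dots> = a \<alpha> * QS \<alpha> ?w" using \<alpha>(1) assms(1) by (simp add: B'_def)
  finally show False using \<alpha>(1) QS_own_content[of \<alpha>] by (simp add: B'_def)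
qed

section \<open>Cutting a tableau at a letter\<close>

definition lower_part :: "nat \<Rightarrow> (nat \<times> nat \<Rightarrow> nat) \<Rightarrow> nat \<times> nat \<Rightarrow> nat" where
  "lower_part N T c = (if N < T c then 0 else T c)"

text \<open>The entries above \<open>N\<close>, moved up by the \<open>m\<close> rows of \<open>\<gamma>\<close> above \<open>\<beta>\<close>. Truncated subtraction
  makes this \<open>0\<close> at every cell with an entry of at most \<open>N\<close>.\<close>

definition upper_part :: "nat \<Rightarrow> nat \<Rightarrow> (nat \<times> nat \<Rightarrow> nat) \<Rightarrow> nat \<times> nat \<Rightarrow> nat" where
  "upper_part N m T c = T (fst c + m, snd c) - N"

lemma inner_cells_shift:
  assumes "lower_left_contained \<beta> \<gamma>"
  shows "(i + (length \<gamma> - length \<beta>), k) \<in> inner_cells \<gamma> \<beta> \<longleftrightarrow> (i, k) \<in> diagram \<beta>"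
proof -
  have "length \<beta> \<le> length \<gamma>" using assms by (simp add: lower_left_contained_def)
  from inner_cells_iff[OF this] show ?thesis by (simp only: le_add2 add_diff_cancel_right' simp_thms)
qed

lemma inner_cells_cases:
  assumes "lower_left_contained \<beta> \<gamma>" "(r, k) \<in> inner_cells \<gamma> \<beta>"
  obtains i where "r = i + (length \<gamma> - length \<beta>)" "(i, k) \<in> diagram \<beta>"
  using assms by (auto simp: inner_cells_def)

text \<open>An entry outside \<open>\<beta>\<close> is at most \<open>N\<close> and thus smaller than every entry inside. This is why in
  the skew tableau a cell of \<open>\<beta>\<close> attacks whatever the entry of the attacked cell is. For the
  upper part, the attack condition on \<open>T\<close> puts an entry larger than \<open>T (j, k + 1) > N\<close> at
  \<open>(i, k + 1)\<close>, so that this cell belongs to \<open>\<beta>\<close>.\<close>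

lemma SSCT_split:
  assumes T: "T \<in> SSCT \<gamma> []" and \<beta>: "lower_left_contained \<beta> \<gamma>"
    and big: "\<And>c. N < T c \<longleftrightarrow> c \<in> inner_cells \<gamma> \<beta>"
  shows "lower_part N T \<in> SSCT \<gamma> \<beta>"
    and "upper_part N (length \<gamma> - length \<beta>) T \<in> SSCT \<beta> []"
proof -
  define m where "m = length \<gamma> - length \<beta>"
  note shift0 = inner_cells_shift[OF \<beta>, folded m_def] and cases0 = inner_cells_cases[OF \<beta>, folded m_def]
  note nz = SSCT_nonzero_iff[OF T, unfolded skew_cells_Nil]
    and row = SSCT_row[OF T, unfolded skew_cells_Nil]
    and col = SSCT_first_column[OF T, unfolded skew_cells_Nil]
    and att = SSCT_straight_attack[OF T]
  let ?S = "skew_cells \<gamma> \<beta>" and ?I = "inner_cells \<gamma> \<beta>" and ?D = "diagram \<gamma>"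
  have S: "c \<in> ?S \<longleftrightarrow> c \<in> ?D \<and> c \<notin> ?I" for c by (simp add: skew_cells_def)
  have I: "c \<in> ?D" if "c \<in> ?I" for c using inner_cells_subset[OF \<beta>] that by blast
  have lo: "lower_part N T c = T c" if "c \<in> ?S" for c
    using that big[of c] S[of c] by (simp add: lower_part_def)
  show "lower_part N T \<in> SSCT \<gamma> \<beta>"
    unfolding SSCT_iff
  proof (intro conjI allI impI)
    show "lower_left_contained \<beta> \<gamma>" by (rule \<beta>)
  next
    fix c
    show "lower_part N T c \<noteq> 0 \<longleftrightarrow> c \<in> ?S"
      using nz[of c] S[of c] big[of c] by (simp add: lower_part_def)
  next
    fix i k k' assume "(i, k) \<in> ?S" "(i, k') \<in> ?S" "k < k'"
    then show "lower_part N T (i, k') \<le> lower_part N T (i, k)"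
      using lo row[of i k k'] S by simp
  next
    fix i j assume "(i, 0) \<in> ?S" "(j, 0) \<in> ?S" "i < j"
    then show "lower_part N T (i, 0) < lower_part N T (j, 0)" using lo col[of i j] S by simp
  next
    fix i j k
    assume a: "(i, k) \<in> ?D" "i < j" "(j, Suc k) \<in> ?S" "(i, Suc k) \<notin> ?I"
      "(i, k) \<in> ?I \<or> lower_part N T (j, Suc k) \<le> lower_part N T (i, k)"
    have "T (j, Suc k) \<le> T (i, k)"
    proof (cases "(i, k) \<in> ?I")
      case True
      then have "N < T (i, k)" "\<not> N < T (j, Suc k)" using big S a by blast+
      then show ?thesis by simp
    next
      case False
      then show ?thesis using a lo[of "(j, Suc k)"] lo[of "(i, k)"] S by simp
    qed
    then have *: "(i, Suc k) \<in> ?D" "T (j, Suc k) < T (i, Suc k)" using att[of i k j] a S by auto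
    then show "(i, Suc k) \<in> ?S" using a S by blast
    then show "lower_part N T (j, Suc k) < lower_part N T (i, Suc k)" using * lo a by simp
  qed
  have up: "upper_part N m T (i, k) = T (i + m, k) - N" for i k by (simp add: upper_part_def)
  have shift: "(i, k) \<in> diagram \<beta> \<longleftrightarrow> N < T (i + m, k)" for i k
    using shift0[of i k] big by blast
  have D: "(i + m, k) \<in> ?D" if "(i, k) \<in> diagram \<beta>" for i k
    using shift0[of i k] I that by blast
  show "upper_part N (length \<gamma> - length \<beta>) T \<in> SSCT \<beta> []"
    unfolding SSCT_straight_iff m_def[symmetric]
  proof (intro conjI allI impI)
    fix c :: "nat \<times> nat"
    show "upper_part N m T c \<noteq> 0 \<longleftrightarrow> c \<in> diagram \<beta>"
      using shift[of "fst c" "snd c"] unfolding upper_part_def by auto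
  next
    fix i k k' assume "(i, k) \<in> diagram \<beta>" "(i, k') \<in> diagram \<beta>" "k < k'"
    then show "upper_part N m T (i, k') \<le> upper_part N m T (i, k)"
      using row[of "i + m" k k'] D unfolding up by (simp add: diff_le_mono)
  next
    fix i j assume "(i, 0) \<in> diagram \<beta>" "(j, 0) \<in> diagram \<beta>" "i < j"
    then show "upper_part N m T (i, 0) < upper_part N m T (j, 0)"
      using col[of "i + m" "j + m"] D shift[of i 0] unfolding up by (simp add: diff_less_mono)
  next
    fix i j k
    assume a: "(i, k) \<in> diagram \<beta>" "i < j" "(j, Suc k) \<in> diagram \<beta>"
      "upper_part N m T (j, Suc k) \<le> upper_part N m T (i, k)"
    have "T (j + m, Suc k) \<le> T (i + m, k)"
      using a(4) shift[of i k] a(1) unfolding up by simp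
    then have *: "T (j + m, Suc k) < T (i + m, Suc k)"
      using att[of "i + m" k "j + m"] a D by simp
    have "N < T (j + m, Suc k)" using shift a(3) by blast
    then show "(i, Suc k) \<in> diagram \<beta>" "upper_part N m T (j, Suc k) < upper_part N m T (i, Suc k)"
      using shift[of i "Suc k"] * unfolding up by simp_all
  qed
qed

text \<open>Two cells compared in a condition on \<open>T\<close> lie both inside \<open>\<beta>\<close>, both outside, or on different
  sides, and in the last case the entry inside is the larger one. In the first column every cell below
  a cell of \<open>\<beta>\<close> is in \<open>\<beta>\<close> because \<open>\<beta>\<close> has no empty rows.\<close>

lemma SSCT_glue:
  assumes \<beta>: "lower_left_contained \<beta> \<gamma>" "composition \<beta>"
    and big: "\<And>c. N < T c \<longleftrightarrow> c \<in> inner_cells \<gamma> \<beta>"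
    and T1: "lower_part N T \<in> SSCT \<gamma> \<beta>"
    and T2: "upper_part N (length \<gamma> - length \<beta>) T \<in> SSCT \<beta> []"
  shows "T \<in> SSCT \<gamma> []"
proof -
  define m where "m = length \<gamma> - length \<beta>"
  note shift0 = inner_cells_shift[OF \<beta>(1), folded m_def] and cases0 = inner_cells_cases[OF \<beta>(1), folded m_def]
  let ?S = "skew_cells \<gamma> \<beta>" and ?I = "inner_cells \<gamma> \<beta>" and ?D = "diagram \<gamma>"
  note T2' = T2[folded m_def]
  note row2 = SSCT_row[OF T2', unfolded skew_cells_Nil]
    and col2 = SSCT_first_column[OF T2', unfolded skew_cells_Nil]
    and att2 = SSCT_straight_attack[OF T2']
  have S: "c \<in> ?S \<longleftrightarrow> c \<in> ?D \<and> c \<notin> ?I" for c by (simp add: skew_cells_def)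
  have I: "c \<in> ?D" if "c \<in> ?I" for c using inner_cells_subset[OF \<beta>(1)] that by blast
  have lo: "lower_part N T c = T c" if "c \<notin> ?I" for c
    using that big[of c] by (simp add: lower_part_def)
  have up: "T (i + m, k) = upper_part N m T (i, k) + N" if "(i + m, k) \<in> ?I" for i k
    using big[of "(i + m, k)"] that by (simp add: upper_part_def)
  have shift: "(i + m, k) \<in> ?I \<longleftrightarrow> (i, k) \<in> diagram \<beta>" for i k
    by (rule shift0)
  show ?thesis
    unfolding SSCT_straight_iff
  proof (intro conjI allI impI)
    fix c
    show "T c \<noteq> 0 \<longleftrightarrow> c \<in> ?D"
    proof (cases "c \<in> ?I")
      case True
      then show ?thesis using big[of c] I by simp
    next
      case False
      then show ?thesis using SSCT_nonzero_iff[OF T1, of c] lo S by simp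
    qed
  next
    fix i k k' assume a: "(i, k) \<in> ?D" "(i, k') \<in> ?D" "k < k'"
    consider "(i, k') \<in> ?I" | "(i, k) \<in> ?I" "(i, k') \<notin> ?I" | "(i, k) \<notin> ?I" "(i, k') \<notin> ?I" by blast
    then show "T (i, k') \<le> T (i, k)"
    proof cases
      case 1
      then have "(i, k) \<in> ?I" using inner_cells_left a by (meson less_imp_le)
      obtain i0 where i0: "i = i0 + m" "(i0, k') \<in> diagram \<beta>" using cases0[OF 1] .
      then show ?thesis
        using 1 \<open>(i, k) \<in> ?I\<close> up shift row2[of i0 k k'] a by simp
    next
      case 2
      then have "N < T (i, k)" "\<not> N < T (i, k')" using big by blast+
      then show ?thesis by simp
    next
      case 3
      then show ?thesis using SSCT_row[OF T1, of i k k'] a lo S by simp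
    qed
  next
    fix i j assume a: "(i, 0) \<in> ?D" "(j, 0) \<in> ?D" "i < j"
    show "T (i, 0) < T (j, 0)"
    proof (cases "(i, 0) \<in> ?I")
      case True
      obtain i0 where i0: "i = i0 + m" "(i0, 0) \<in> diagram \<beta>" using cases0[OF True] .
      define j0 where "j0 = j - m"
      have j0: "j = j0 + m" "j0 < length \<beta>" "i0 < j0"
        using i0 a \<beta>(1) by (auto simp: j0_def m_def diagram_def lower_left_contained_def)
      then have "(j0, 0) \<in> diagram \<beta>" using \<beta>(2) by (auto simp: diagram_def composition_def)
      then show ?thesis using up shift col2[of i0 j0] i0 j0 by simp
    next
      case False
      show ?thesis
      proof (cases "(j, 0) \<in> ?I")
        case True
        then have "\<not> N < T (i, 0)" "N < T (j, 0)" using False big by blast+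
        then show ?thesis by simp
      next
        case False
        then show ?thesis using \<open>(i, 0) \<notin> ?I\<close> SSCT_first_column[OF T1, of i j] a lo S by simp
      qed
    qed
  next
    fix i j k
    assume a: "(i, k) \<in> ?D" "i < j" "(j, Suc k) \<in> ?D" "T (j, Suc k) \<le> T (i, k)"
    have "(i, Suc k) \<in> ?D \<and> T (j, Suc k) < T (i, Suc k)"
    proof (cases "(j, Suc k) \<in> ?I")
      case True
      then have "N < T (j, Suc k)" using big by blast
      then have ik: "(i, k) \<in> ?I" using a(4) big[of "(i, k)"] by simp
      obtain i0 where i0: "i = i0 + m" "(i0, k) \<in> diagram \<beta>" using cases0[OF ik] .
      obtain j0 where j0: "j = j0 + m" "(j0, Suc k) \<in> diagram \<beta>" using cases0[OF True] .
      have "upper_part N m T (j0, Suc k) \<le> upper_part N m T (i0, k)"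
        using a(4) i0 j0 up shift by simp
      then have *: "(i0, Suc k) \<in> diagram \<beta>"
        "upper_part N m T (j0, Suc k) < upper_part N m T (i0, Suc k)"
        using att2[of i0 k j0] i0 j0 a by auto
      then have "(i, Suc k) \<in> ?I" using shift i0 by simp
      then show ?thesis using I * up shift i0 j0 by simp
    next
      case False
      then have jS: "(j, Suc k) \<in> ?S" "\<not> N < T (j, Suc k)" using a S big by blast+
      show ?thesis
      proof (cases "(i, Suc k) \<in> ?I")
        case True
        then have "N < T (i, Suc k)" using big by blast
        then show ?thesis using jS I True by simp
      next
        case nI: False
        have "(i, k) \<in> ?I \<or> lower_part N T (j, Suc k) \<le> lower_part N T (i, k)"
          using a(4) lo[of "(i, k)"] lo[of "(j, Suc k)"] False by (cases "(i, k) \<in> ?I") simp_all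
        then have "(i, Suc k) \<in> ?S \<and> lower_part N T (j, Suc k) < lower_part N T (i, Suc k)"
          by (rule SSCT_attack[OF T1 a(1,2) jS(1) nI])
        then show ?thesis using lo False nI S by simp
      qed
    qed
    then show "(i, Suc k) \<in> ?D" "T (j, Suc k) < T (i, Suc k)" by blast+
  qed
qed

lemma cont_split:
  assumes T: "T \<in> SSCT \<gamma> []" and \<beta>: "lower_left_contained \<beta> \<gamma>"
    and big: "\<And>c. N < T c \<longleftrightarrow> c \<in> inner_cells \<gamma> \<beta>"
  shows "cont T = join N (cont (lower_part N T)) (cont (upper_part N (length \<gamma> - length \<beta>) T))"
    and "Poly_Mapping.keys (cont (lower_part N T)) \<subseteq> {..<N}"
proof -
  define m where "m = length \<gamma> - length \<beta>"
  note shift0 = inner_cells_shift[OF \<beta>, folded m_def] and cases0 = inner_cells_cases[OF \<beta>, folded m_def]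
  note T12 = SSCT_split[OF T \<beta> big, folded m_def]
  show "cont T = join N (cont (lower_part N T)) (cont (upper_part N (length \<gamma> - length \<beta>) T))"
    unfolding m_def[symmetric]
  proof (rule poly_mapping_eqI)
    fix x
    have "card {c. T c = Suc x} = (if x < N then card {c. lower_part N T c = Suc x}
        else card {c. upper_part N m T c = Suc (x - N)})"
    proof (cases "x < N")
      case True
      then have "{c. T c = Suc x} = {c. lower_part N T c = Suc x}" by (auto simp: lower_part_def)
      then show ?thesis using True by simp
    next
      case False
      let ?f = "\<lambda>c :: nat \<times> nat. (fst c + m, snd c)"
      have up: "upper_part N m T c = Suc (x - N) \<longleftrightarrow> T (?f c) = Suc x" for c
        using False by (auto simp: upper_part_def)
      have "{c. T c = Suc x} = ?f ` {c. upper_part N m T c = Suc (x - N)}"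
      proof
        show "{c. T c = Suc x} \<subseteq> ?f ` {c. upper_part N m T c = Suc (x - N)}"
        proof clarify
          fix r k assume rk: "T (r, k) = Suc x"
          then have "(r, k) \<in> inner_cells \<gamma> \<beta>" using big[of "(r, k)"] False by simp
          then obtain i where i: "r = i + m" using cases0 by blast
          then show "(r, k) \<in> ?f ` {c. upper_part N m T c = Suc (x - N)}"
            using rk up[of "(i, k)"] by (intro image_eqI[where x = "(i, k)"]) simp_all
        qed
      qed (use up in blast)
      moreover have "inj_on ?f {c. upper_part N m T c = Suc (x - N)}" by (auto simp: inj_on_def)
      ultimately show ?thesis using False by (simp add: card_image)
    qed
    then show "Poly_Mapping.lookup (cont T) x =
        Poly_Mapping.lookup (join N (cont (lower_part N T)) (cont (upper_part N m T))) x"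
      by (simp add: lookup_join lookup_cont_SSCT[OF T] lookup_cont_SSCT[OF T12(1)] lookup_cont_SSCT[OF T12(2)])
  qed
  show "Poly_Mapping.keys (cont (lower_part N T)) \<subseteq> {..<N}"
  proof
    fix x assume "x \<in> Poly_Mapping.keys (cont (lower_part N T))"
    then have "card {c. lower_part N T c = Suc x} \<noteq> 0"
      unfolding lookup_cont_SSCT[OF T12(1), symmetric] by (rule iffD1[OF in_keys_iff])
    then have "{c. lower_part N T c = Suc x} \<noteq> {}" by (metis card.empty)
    then obtain c where "lower_part N T c = Suc x" by blast
    then show "x \<in> {..<N}" by (simp add: lower_part_def split: if_splits)
  qed
qed

lemma join_inject:
  assumes "Poly_Mapping.keys u \<subseteq> {..<N}" "Poly_Mapping.keys u' \<subseteq> {..<N}" "join N u v = join N u' v'"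
  shows "u = u'" "v = v'"
proof -
  have *: "Poly_Mapping.lookup (join N u v) i = Poly_Mapping.lookup (join N u' v') i" for i
    using assms(3) by simp
  show "u = u'"
  proof (rule poly_mapping_eqI)
    fix i
    show "Poly_Mapping.lookup u i = Poly_Mapping.lookup u' i"
    proof (cases "i < N")
      case True
      then show ?thesis using *[of i] by (simp add: lookup_join)
    next
      case False
      then have "i \<notin> Poly_Mapping.keys u" "i \<notin> Poly_Mapping.keys u'" using assms by auto
      then show ?thesis by (simp only: not_in_keys_iff_lookup_eq_zero)
    qed
  qed
  show "v = v'"
  proof (rule poly_mapping_eqI)
    fix i
    show "Poly_Mapping.lookup v i = Poly_Mapping.lookup v' i"
      using *[of "i + N"] by (simp add: lookup_join)
  qed
qed

lemma bij_betw_split: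
  assumes \<beta>: "lower_left_contained \<beta> \<gamma>" "composition \<beta>" and u: "Poly_Mapping.keys u \<subseteq> {..<N}"
  shows "bij_betw (\<lambda>T. (lower_part N T, upper_part N (length \<gamma> - length \<beta>) T))
    {T \<in> SSCT \<gamma> []. cont T = join N u v \<and> {c. N < T c} = inner_cells \<gamma> \<beta>}
    ({T \<in> SSCT \<gamma> \<beta>. cont T = u} \<times> {T \<in> SSCT \<beta> []. cont T = v})"
    (is "bij_betw ?f ?A (?B \<times> ?C)")
proof -
  define m where "m = length \<gamma> - length \<beta>"
  note shift0 = inner_cells_shift[OF \<beta>(1), folded m_def] and cases0 = inner_cells_cases[OF \<beta>(1), folded m_def]
  let ?f = "\<lambda>T. (lower_part N T, upper_part N m T)" and ?I = "inner_cells \<gamma> \<beta>"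
  have "inj_on ?f ?A"
  proof (rule inj_onI)
    fix T T' assume T: "T \<in> ?A" "T' \<in> ?A" "?f T = ?f T'"
    have big: "N < T c \<longleftrightarrow> c \<in> ?I" "N < T' c \<longleftrightarrow> c \<in> ?I" for c using T by blast+
    show "T = T'"
    proof (rule ext, clarify)
      fix r k
      show "T (r, k) = T' (r, k)"
      proof (cases "(r, k) \<in> ?I")
        case True
        then obtain i where i: "r = i + m" using cases0 by blast
        have "upper_part N m T (i, k) = upper_part N m T' (i, k)" using T(3) by simp
        then show ?thesis using big[of "(r, k)"] True i by (simp add: upper_part_def)
      next
        case False
        have "lower_part N T (r, k) = lower_part N T' (r, k)" using T(3) by simp
        then show ?thesis using big[of "(r, k)"] False by (simp add: lower_part_def)
      qed
    qed
  qed
  moreover have "?f T \<in> ?B \<times> ?C" if "T \<in> ?A" for T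
  proof -
    have T: "T \<in> SSCT \<gamma> []" "cont T = join N u v" and big: "\<And>c. N < T c \<longleftrightarrow> c \<in> ?I"
      using that by blast+
    note cs = cont_split[OF T(1) \<beta>(1) big, folded m_def]
    have "join N (cont (lower_part N T)) (cont (upper_part N m T)) = join N u v"
      using cs(1) T(2) by (rule trans[OF sym])
    then have "cont (lower_part N T) = u" "cont (upper_part N m T) = v"
      by (rule join_inject[OF cs(2) u])+
    then show ?thesis using SSCT_split[OF T(1) \<beta>(1) big, folded m_def] by simp
  qed
  moreover have "p \<in> ?f ` ?A" if p: "p \<in> ?B \<times> ?C" for p
  proof -
    obtain T1 T2 where T12: "p = (T1, T2)" "T1 \<in> SSCT \<gamma> \<beta>" "cont T1 = u" "T2 \<in> SSCT \<beta> []" "cont T2 = v"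
      using p by blast
    define T where "T c = (if c \<in> ?I then T2 (fst c - m, snd c) + N else T1 c)" for c
    have T1_le: "T1 c \<le> N" for c
    proof (cases "T1 c")
      case (Suc x)
      then have "c \<in> {c. T1 c = Suc x}" by simp
      moreover have "finite {c. T1 c = Suc x}"
        by (rule finite_subset[OF _ SSCT_finite[OF T12(2)]]) auto
      ultimately have "card {c. T1 c = Suc x} \<noteq> 0" by (metis card_0_eq empty_iff)
      then have "Poly_Mapping.lookup u x \<noteq> 0" using lookup_cont_SSCT[OF T12(2), of x] T12(3) by simp
      then have "x \<in> Poly_Mapping.keys u" by (rule iffD2[OF in_keys_iff])
      then show ?thesis using u Suc by auto
    qed simp
    have T2_pos: "0 < T2 c \<longleftrightarrow> c \<in> diagram \<beta>" for c
      using SSCT_nonzero_iff[OF T12(4), of c] by simp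
    have big: "N < T c \<longleftrightarrow> c \<in> ?I" for c
    proof (cases "c \<in> ?I")
      case True
      then obtain i where i: "fst c = i + m" "(i, snd c) \<in> diagram \<beta>"
        using cases0[of "fst c" "snd c"] by auto
      then show ?thesis using True T2_pos[of "(i, snd c)"] by (simp add: T_def)
    next
      case False
      then show ?thesis using T1_le[of c] by (simp add: T_def)
    qed
    have lo: "lower_part N T = T1"
    proof
      fix c
      show "lower_part N T c = T1 c"
      proof (cases "c \<in> ?I")
        case True
        then have "c \<notin> skew_cells \<gamma> \<beta>" by (simp add: skew_cells_def)
        then have "T1 c = 0" using SSCT_nonzero_iff[OF T12(2)] by blast
        then show ?thesis using True big[of c] by (simp add: lower_part_def)
      next
        case False
        then show ?thesis using big[of c] by (simp add: lower_part_def T_def)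
      qed
    qed
    have up: "upper_part N m T = T2"
    proof (rule ext, clarify)
      fix i k
      show "upper_part N m T (i, k) = T2 (i, k)"
      proof (cases "(i, k) \<in> diagram \<beta>")
        case True
        then show ?thesis using shift0[of i k] by (simp add: upper_part_def T_def)
      next
        case False
        then have "\<not> N < T (i + m, k)" using shift0[of i k] big by blast
        then show ?thesis using False T2_pos[of "(i, k)"] by (simp add: upper_part_def)
      qed
    qed
    have T: "T \<in> SSCT \<gamma> []"
      by (rule SSCT_glue[OF \<beta> big, folded m_def]) (simp_all only: lo up T12)
    have "cont T = join N u v" using cont_split(1)[OF T \<beta>(1) big, folded m_def] by (simp only: lo up T12)
    then show ?thesis using T big T12(1) lo up by (intro image_eqI[where x = T]) auto
  qed
  ultimately show ?thesis unfolding bij_betw_def m_def[symmetric] by blast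
qed

text \<open>As all parts are positive, the first column of the placed diagram gives the number of rows.\<close>

lemma inner_cells_inject:
  assumes "lower_left_contained \<beta> \<gamma>" "composition \<beta>" "lower_left_contained \<beta>' \<gamma>" "composition \<beta>'"
    and eq: "inner_cells \<gamma> \<beta> = inner_cells \<gamma> \<beta>'"
  shows "\<beta> = \<beta>'"
proof -
  have rows: "{r. (r, 0) \<in> inner_cells \<gamma> \<alpha>} = {length \<gamma> - length \<alpha>..<length \<gamma>}"
    if "lower_left_contained \<alpha> \<gamma>" "composition \<alpha>" for \<alpha>
    using that by (auto simp: inner_cells_iff lower_left_contained_def diagram_def composition_def)
  have len: "length \<alpha> = card {r. (r, 0) \<in> inner_cells \<gamma> \<alpha>}"
    if "lower_left_contained \<alpha> \<gamma>" "composition \<alpha>" for \<alpha>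
    using rows[OF that] that by (simp add: lower_left_contained_def)
  have l: "length \<beta> = length \<beta>'" using len[OF assms(1,2)] len[OF assms(3,4)] eq by simp
  show ?thesis
  proof (rule nth_equalityI[OF l])
    fix i assume i: "i < length \<beta>"
    have "k < \<beta> ! i \<longleftrightarrow> k < \<beta>' ! i" for k
      using inner_cells_shift[OF assms(1), of i k] inner_cells_shift[OF assms(3), of i k] eq l i
      by (simp add: diagram_def)
    then show "\<beta> ! i = \<beta>' ! i" by (metis less_irrefl nat_neq_iff)
  qed
qed

lemma down_closed_eq_lessThan:
  assumes "finite S" "\<And>x y :: nat. y \<in> S \<Longrightarrow> x \<le> y \<Longrightarrow> x \<in> S"
  shows "S = {..<card S}"
proof (cases "S = {}")
  case False
  then have "S = {..Max S}" using assms by (auto intro: Max_ge)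
       (metis Max_in assms(2) False)
  then have "S = {..<Suc (Max S)}" by (simp add: lessThan_Suc_atMost)
  then show ?thesis by (metis card_lessThan)
qed simp

text \<open>Rows decrease, so the entries above \<open>N\<close> form an initial segment of length \<open>m r\<close> in each row
  \<open>r\<close>. The first column increases, so the rows with \<open>m r = 0\<close> are the first \<open>off\<close> rows.\<close>

lemma ex_shape_of_large_entries:
  assumes \<gamma>: "composition \<gamma>" and T: "T \<in> SSCT \<gamma> []"
  shows "\<exists>\<beta>. composition \<beta> \<and> lower_left_contained \<beta> \<gamma> \<and> {c. N < T c} = inner_cells \<gamma> \<beta>"
proof -
  note nz = SSCT_nonzero_iff[OF T, unfolded skew_cells_Nil]
    and row = SSCT_row[OF T, unfolded skew_cells_Nil]
    and col = SSCT_first_column[OF T, unfolded skew_cells_Nil]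
  have D: "c \<in> diagram \<gamma>" if "N < T c" for c using nz[of c] that by simp
  define m where "m r = card {k. N < T (r, k)}" for r
  have m: "N < T (r, k) \<longleftrightarrow> k < m r" for r k
  proof -
    have "{k. N < T (r, k)} \<subseteq> {..<\<gamma> ! r}" using D by (auto simp: diagram_def)
    then have fin: "finite {k. N < T (r, k)}" by (rule finite_subset) simp
    have "{k. N < T (r, k)} = {..<card {k. N < T (r, k)}}"
    proof (rule down_closed_eq_lessThan[OF fin])
      fix x y assume y: "y \<in> {k. N < T (r, k)}" "x \<le> y"
      then have "(r, y) \<in> diagram \<gamma>" using D by simp
      then have "T (r, y) \<le> T (r, x)" using row diagram_left y by blast
      then show "x \<in> {k. N < T (r, k)}" using y by simp
    qed
    then show ?thesis unfolding m_def by blast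
  qed
  have m_le: "m r \<le> \<gamma> ! r \<and> r < length \<gamma>" if "0 < m r" for r
  proof -
    have "(r, m r - 1) \<in> diagram \<gamma>" using m[of r "m r - 1"] D that by simp
    then show ?thesis by (auto simp: diagram_def)
  qed
  define off where "off = card {r. r < length \<gamma> \<and> m r = 0}"
  have "{r. r < length \<gamma> \<and> m r = 0} = {..<off}"
    unfolding off_def
  proof (rule down_closed_eq_lessThan)
    fix x y assume y: "y \<in> {r. r < length \<gamma> \<and> m r = 0}" "x \<le> y"
    have "T (x, 0) \<le> T (y, 0)"
    proof (cases "x = y")
      case False
      then have "(x, 0) \<in> diagram \<gamma>" "(y, 0) \<in> diagram \<gamma>" "x < y"
        using y \<gamma> by (auto simp: diagram_def composition_def)
      then show ?thesis using col by (meson less_imp_le)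
    qed simp
    moreover have "\<not> N < T (y, 0)" using y m[of y 0] by simp
    ultimately have "\<not> N < T (x, 0)" by simp
    then show "x \<in> {r. r < length \<gamma> \<and> m r = 0}" using m[of x 0] y by simp
  qed simp
  then have off: "r < length \<gamma> \<and> m r = 0 \<longleftrightarrow> r < off" for r by blast
  have off_le: "off \<le> length \<gamma>"
    unfolding off_def by (rule order_trans[OF card_mono[of "{..<length \<gamma>}"]]) auto
  define \<beta> where "\<beta> = map m [off..<length \<gamma>]"
  have len: "length \<beta> = length \<gamma> - off" by (simp add: \<beta>_def)
  have nth: "\<beta> ! i = m (i + off)" if "i < length \<beta>" for i using that by (simp add: \<beta>_def add.commute)
  have pos: "0 < m r" if "off \<le> r" "r < length \<gamma>" for r using off[of r] that by auto
  have "composition \<beta>" using pos by (auto simp: composition_def \<beta>_def)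
  moreover have ll: "lower_left_contained \<beta> \<gamma>"
    unfolding lower_left_contained_def
  proof (intro conjI allI impI)
    show "length \<beta> \<le> length \<gamma>" by (simp add: len)
    fix i assume i: "i < length \<beta>"
    then have "\<beta> ! (length \<beta> - Suc i) = m (length \<gamma> - Suc i)"
      using nth[of "length \<beta> - Suc i"] len off_le by simp
    then show "\<beta> ! (length \<beta> - Suc i) \<le> \<gamma> ! (length \<gamma> - Suc i)"
      using m_le[of "length \<gamma> - Suc i"] by (cases "m (length \<gamma> - Suc i) = 0") auto
  qed
  moreover have "{c. N < T c} = inner_cells \<gamma> \<beta>"
  proof (rule set_eqI, clarify)
    fix r k
    have off': "length \<gamma> - length \<beta> = off" using len off_le by simp
    have "(r, k) \<in> inner_cells \<gamma> \<beta> \<longleftrightarrow> off \<le> r \<and> r < length \<gamma> \<and> k < m r"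
      using ll nth[of "r - off"] off_le
      by (auto simp: inner_cells_iff lower_left_contained_def off' diagram_def len)
    moreover have "N < T (r, k) \<longleftrightarrow> off \<le> r \<and> r < length \<gamma> \<and> k < m r"
      using m[of r k] m_le[of r] off[of r] by (cases "m r = 0") auto
    ultimately show "(r, k) \<in> {c. N < T c} \<longleftrightarrow> (r, k) \<in> inner_cells \<gamma> \<beta>" by simp
  qed
  ultimately show ?thesis by blast
qed

lemma finite_contained: "finite {\<beta>. composition \<beta> \<and> lower_left_contained \<beta> \<gamma>}"
proof (rule finite_subset)
  show "{\<beta>. composition \<beta> \<and> lower_left_contained \<beta> \<gamma>} \<subseteq>
      {xs. set xs \<subseteq> {..sum_list \<gamma>} \<and> length xs \<le> length \<gamma>}"
  proof clarify
    fix \<beta> assume \<beta>: "lower_left_contained \<beta> \<gamma>"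
    then have len: "length \<beta> \<le> length \<gamma>" by (simp add: lower_left_contained_def)
    have "b \<le> sum_list \<gamma>" if b: "b \<in> set \<beta>" for b
    proof -
      obtain i where i: "i < length \<beta>" "b = \<beta> ! i" using b by (metis in_set_conv_nth)
      define j where "j = length \<beta> - Suc i"
      have j: "j < length \<beta>" "i = length \<beta> - Suc j" using i by (auto simp: j_def)
      then have "b \<le> \<gamma> ! (length \<gamma> - Suc j)" using \<beta> i unfolding lower_left_contained_def by blast
      also have "\<dots> \<le> sum_list \<gamma>" using j len by (intro elem_le_sum_list) auto
      finally show ?thesis .
    qed
    then show "set \<beta> \<subseteq> {..sum_list \<gamma>} \<and> length \<beta> \<le> length \<gamma>" using len by auto
  qed
qed (simp add: finite_lists_length_le)

text \<open>Classify the tableaux of content \<open>join N u v\<close> by the shape of their entries above \<open>N\<close>.\<close>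

lemma QS_apply_join:
  assumes \<gamma>: "composition \<gamma>" and u: "Poly_Mapping.keys u \<subseteq> {..<N}"
  shows "QS \<gamma> (join N u v) = (\<Sum>\<beta> | composition \<beta> \<and> lower_left_contained \<beta> \<gamma>.
    formal_sum (\<lambda>T. monom (cont T)) (SSCT \<gamma> \<beta>) u * QS \<beta> v)"
proof -
  let ?C = "{\<beta>. composition \<beta> \<and> lower_left_contained \<beta> \<gamma>}"
  define A where "A \<beta> = {T \<in> SSCT \<gamma> []. cont T = join N u v \<and> {c. N < T c} = inner_cells \<gamma> \<beta>}" for \<beta>
  have "{T \<in> SSCT \<gamma> []. cont T = join N u v} = (\<Union>\<beta>\<in>?C. A \<beta>)"
  proof
    show "{T \<in> SSCT \<gamma> []. cont T = join N u v} \<subseteq> (\<Union>\<beta>\<in>?C. A \<beta>)"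
    proof
      fix T assume T: "T \<in> {T \<in> SSCT \<gamma> []. cont T = join N u v}"
      then obtain \<beta> where "composition \<beta> \<and> lower_left_contained \<beta> \<gamma> \<and> {c. N < T c} = inner_cells \<gamma> \<beta>"
        using ex_shape_of_large_entries[OF \<gamma>] by blast
      then show "T \<in> (\<Union>\<beta>\<in>?C. A \<beta>)" using T unfolding A_def by blast
    qed
  qed (auto simp: A_def)
  moreover have "card (\<Union>\<beta>\<in>?C. A \<beta>) = (\<Sum>\<beta>\<in>?C. card (A \<beta>))"
  proof (rule card_UN_disjoint[OF finite_contained])
    show "\<forall>\<beta>\<in>?C. finite (A \<beta>)"
    proof
      fix \<beta>
      show "finite (A \<beta>)"
        by (rule finite_subset[OF _ finite_SSCT_cont[of \<gamma> "[]" "join N u v"]]) (auto simp: A_def)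
    qed
    show "\<forall>\<beta>\<in>?C. \<forall>\<beta>'\<in>?C. \<beta> \<noteq> \<beta>' \<longrightarrow> A \<beta> \<inter> A \<beta>' = {}"
      using inner_cells_inject unfolding A_def by fast
  qed
  moreover have "card (A \<beta>) = card {T \<in> SSCT \<gamma> \<beta>. cont T = u} * card {T \<in> SSCT \<beta> []. cont T = v}"
    if "\<beta> \<in> ?C" for \<beta>
    using bij_betw_same_card[OF bij_betw_split[of \<beta> \<gamma> u N v]] that u
    by (simp add: A_def card_cartesian_product)
  ultimately show ?thesis
    unfolding QS_apply formal_sum_monom_apply by (simp add: of_nat_sum)
qed

section \<open>Skew quasisymmetric Schur functions\<close>

lemma SSCT_series_zero_if_not_contained:
  "\<not> lower_left_contained \<beta> \<gamma> \<Longrightarrow> formal_sum (\<lambda>T. monom (cont T)) (SSCT \<gamma> \<beta>) = 0"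
proof -
  assume "\<not> lower_left_contained \<beta> \<gamma>"
  then have "SSCT \<gamma> \<beta> = {}" using SSCT_contained by blast
  then show ?thesis by (auto simp: formal_sum_def)
qed

lemma coproduct_QS_apply:
  assumes "composition \<gamma>"
  shows "coproduct (QS \<gamma>) (u, v) = (\<Sum>\<beta> | composition \<beta> \<and> lower_left_contained \<beta> \<gamma>.
    formal_sum (\<lambda>T. monom (cont T)) (SSCT \<gamma> \<beta>) u * QS \<beta> v)"
proof -
  obtain N where N: "Poly_Mapping.keys u \<subseteq> {..<N}" using ex_keys_bound by blast
  have "QS \<gamma> \<in> QSym" unfolding QS_def by (rule SSCT_series_in_QSym)
  then show ?thesis using coproduct_apply_join[OF _ N] QS_apply_join[OF assms N] by simp
qed

lemma is_skew_family_SSCT_series: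
  assumes "composition \<gamma>"
  shows "is_skew_family \<gamma> (\<lambda>\<beta>. formal_sum (\<lambda>T. monom (cont T)) (SSCT \<gamma> \<beta>))"
proof -
  let ?F = "\<lambda>\<beta>. formal_sum (\<lambda>T. monom (cont T)) (SSCT \<gamma> \<beta>)"
  let ?C = "{\<beta>. composition \<beta> \<and> lower_left_contained \<beta> \<gamma>}" and ?B = "{\<beta>. composition \<beta> \<and> ?F \<beta> \<noteq> 0}"
  have sub: "?B \<subseteq> ?C" using SSCT_series_zero_if_not_contained by blast
  have "coproduct (QS \<gamma>) = (\<Sum>\<beta>\<in>?B. tensor (?F \<beta>) (QS \<beta>))"
  proof (rule ext, clarify)
    fix u v
    have "coproduct (QS \<gamma>) (u, v) = (\<Sum>\<beta>\<in>?C. ?F \<beta> u * QS \<beta> v)" by (rule coproduct_QS_apply[OF assms])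
    also have "\<dots> = (\<Sum>\<beta>\<in>?B. ?F \<beta> u * QS \<beta> v)"
      by (rule sum.mono_neutral_right[OF finite_contained sub]) auto
    finally show "coproduct (QS \<gamma>) (u, v) = (\<Sum>\<beta>\<in>?B. tensor (?F \<beta>) (QS \<beta>)) (u, v)"
      by (simp add: sum_fun_apply tensor_def)
  qed
  then show ?thesis
    unfolding is_skew_family_def
    using SSCT_series_in_QSym finite_subset[OF sub finite_contained] by blast
qed

text \<open>Compare the coefficients at a fixed exponent \<open>u\<close> in the left variables and use linear independence
  in the right variables.\<close>

lemma is_skew_family_unique:
  assumes s: "is_skew_family \<gamma> s" and s': "is_skew_family \<gamma> s'" and \<beta>: "composition \<beta>"
  shows "s \<beta> = s' \<beta>"
proof -
  let ?S = "\<lambda>s. {\<beta>. composition \<beta> \<and> s \<beta> \<noteq> (0 :: series)}"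
  let ?B = "?S s \<union> ?S s'"
  have fin: "finite ?B" using s s' by (simp add: is_skew_family_def)
  have cop: "coproduct (QS \<gamma>) (u, v) = (\<Sum>\<beta>\<in>?B. t \<beta> u * QS \<beta> v)"
    if t: "is_skew_family \<gamma> t" "?S t \<subseteq> ?B" for t u v
  proof -
    have "coproduct (QS \<gamma>) (u, v) = (\<Sum>\<beta>\<in>?S t. t \<beta> u * QS \<beta> v)"
      using t(1) by (simp add: is_skew_family_def sum_fun_apply tensor_def)
    also have "\<dots> = (\<Sum>\<beta>\<in>?B. t \<beta> u * QS \<beta> v)"
      by (rule sum.mono_neutral_left[OF fin t(2)]) auto
    finally show ?thesis .
  qed
  have "s \<beta> u - s' \<beta> u = 0" if "\<beta> \<in> ?B" for u
  proof (rule QS_independent[OF fin _ _ that])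
    fix v
    show "(\<Sum>\<beta>\<in>?B. (s \<beta> u - s' \<beta> u) * QS \<beta> v) = 0"
      using cop[OF s, of u v] cop[OF s', of u v] by (simp add: left_diff_distrib sum_subtractf)
  qed blast
  then show ?thesis using \<beta> by (cases "\<beta> \<in> ?B") auto
qed

theorem proposition3p1:
  fixes \<beta> \<gamma> :: "nat list"
  assumes "composition \<beta>" and "composition \<gamma>"
  shows "skew_QS \<gamma> \<beta> = formal_sum (\<lambda>T. monom (cont T)) (SSCT \<gamma> \<beta>) \<and>
    formal_sum (\<lambda>T. monom (cont T)) (SSCT \<gamma> \<beta>) = (\<Sum>T \<in> SCT \<gamma> \<beta>. L (Des T))"
proof
  let ?F = "\<lambda>\<beta>. formal_sum (\<lambda>T. monom (cont T)) (SSCT \<gamma> \<beta>)"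
  have F: "is_skew_family \<gamma> ?F" by (rule is_skew_family_SSCT_series[OF assms(2)])
  show "skew_QS \<gamma> \<beta> = ?F \<beta>"
    unfolding skew_QS_def
  proof (rule the_equality)
    show "\<exists>s. is_skew_family \<gamma> s \<and> ?F \<beta> = s \<beta>" using F by (intro exI[of _ ?F] conjI refl)
  next
    fix f assume "\<exists>s. is_skew_family \<gamma> s \<and> f = s \<beta>"
    then obtain s where "is_skew_family \<gamma> s" "f = s \<beta>" by blast
    then show "f = ?F \<beta>" using is_skew_family_unique[OF _ F assms(1)] by simp
  qed
  show "?F \<beta> = (\<Sum>T \<in> SCT \<gamma> \<beta>. L (Des T))" by (rule SSCT_series_eq_sum_L)
qed

end
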